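(* No complex structure on a hyperplane of $Z_2$ is compatible with the Kalton-Peck map $\mathscr K$. That is: let $Y=\{(x,0):x\in\ell_2\}\subset Z_2$ be the canonical copy of $\ell_2$, let $H$ be any closed subspace of $Z_2$ of codimension $1$, and let $u:H\to H$ be any bounded linear operator with $u^2=-\mathrm{id}_H$; then $u(H\cap Y)\not\subset Y$.
   Context: All spaces are real. The Kalton-Peck map on $\ell_2$ is $\mathscr K(x)=\left(x_i\log\frac{|x_i|}{\|x\|_2}\right)_i$, with the convention that the $i$-th coordinate is $0$ if $x_i=0$. The Kalton-Peck space is $Z_2=\{(w,x): w\in\mathbb R^{\mathbb N},\ x\in\ell_2,\ w-\mathscr Kx\in\ell_2\}$ with the quasi-norm $\|(w,x)\|=\|w-\mathscr Kx\|_2+\|x\|_2$, which is equivalent to a norm making $Z_2$ a Banach space. There is an exact sequence $0\to\ell_2\to Z_2\to\ell_2\to0$ with inclusion $x\mapsto(x,0)$ and quotient map $(w,x)\mapsto x$. A complex structure on a real Banach space $X$ is a bounded linear operator $u:X\to X$ with $u^2=-\mathrm{id}_X$. Given an exact sequence $0\to Y\to X\to Z\to0$ with associated quasi-linear map $\Omega$, a complex structure $u$ on a hyperplane (closed $1$-codimensional subspace) $H$ of $X$ is called compatible with $\Omega$ if $u(H\cap Y)\subset Y$. *)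

theory Defs
  imports "HOL-Analysis.Analysis" "HOL-Library.Function_Algebras"
begin

text \<open>Pointwise scalar multiplication. Together with the pointwise addition of
  Function_Algebras it makes the sequence space, and hence its square, a real vector space,
  so that the library's \<^const>\<open>subspace\<close> applies.\<close>

instantiation "fun" :: (type, real_vector) real_vector
begin

definition scaleR_fun_def: "c *\<^sub>R f = (\<lambda>i. c *\<^sub>R f i)"

instance
  by standard (auto simp: scaleR_fun_def fun_eq_iff scaleR_add_right scaleR_add_left)

end

definition ell2 :: "(nat \<Rightarrow> real) set" where
  "ell2 = {x. summable (\<lambda>i. (x i)\<^sup>2)}"

definition ell2_norm :: "(nat \<Rightarrow> real) \<Rightarrow> real" where
  "ell2_norm x = sqrt (\<Sum>i. (x i)\<^sup>2)"

definition kalton_peck :: "(nat \<Rightarrow> real) \<Rightarrow> (nat \<Rightarrow> real)" where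
  "kalton_peck x = (\<lambda>i. if x i = 0 then 0 else x i * ln (\<bar>x i\<bar> / ell2_norm x))"

definition Z2 :: "((nat \<Rightarrow> real) \<times> (nat \<Rightarrow> real)) set" where
  "Z2 = {(w, x). x \<in> ell2 \<and> w - kalton_peck x \<in> ell2}"

definition Z2_norm :: "(nat \<Rightarrow> real) \<times> (nat \<Rightarrow> real) \<Rightarrow> real" where
  "Z2_norm = (\<lambda>(w, x). ell2_norm (w - kalton_peck x) + ell2_norm x)"

definition ell2_in_Z2 :: "((nat \<Rightarrow> real) \<times> (nat \<Rightarrow> real)) set" where
  "ell2_in_Z2 = (\<lambda>x. (x, 0)) ` ell2"

text \<open>The linear topology on a carrier \<open>X\<close> given by a quasi-norm \<open>N\<close>. Balls of a quasi-norm
  need not be open, but they form a base of neighbourhoods. No topology of the ambient type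
  (such as the product topology) is involved.\<close>

definition quasinorm_topology :: "'a::real_vector set \<Rightarrow> ('a \<Rightarrow> real) \<Rightarrow> 'a topology" where
  "quasinorm_topology X N =
     topology (\<lambda>U. U \<subseteq> X \<and> (\<forall>z\<in>U. \<exists>e>0. \<forall>y\<in>X. N (y - z) < e \<longrightarrow> y \<in> U))"

lemma openin_quasinorm_topology:
  "openin (quasinorm_topology X N) U \<longleftrightarrow>
     U \<subseteq> X \<and> (\<forall>z\<in>U. \<exists>e>0. \<forall>y\<in>X. N (y - z) < e \<longrightarrow> y \<in> U)"
proof -
  let ?P = "\<lambda>U. U \<subseteq> X \<and> (\<forall>z\<in>U. \<exists>e>0. \<forall>y\<in>X. N (y - z) < e \<longrightarrow> y \<in> U)"
  have "?P (S \<inter> T)" if S: "?P S" and T: "?P T" for S T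
  proof (intro conjI ballI)
    show "S \<inter> T \<subseteq> X" using S by blast
    fix z assume "z \<in> S \<inter> T"
    then obtain d e where "d > 0" "\<forall>y\<in>X. N (y - z) < d \<longrightarrow> y \<in> S"
      and "e > 0" "\<forall>y\<in>X. N (y - z) < e \<longrightarrow> y \<in> T"
      using S T by blast
    then show "\<exists>e>0. \<forall>y\<in>X. N (y - z) < e \<longrightarrow> y \<in> S \<inter> T"
      by (intro exI[of _ "min d e"]) auto
  qed
  moreover have "?P (\<Union>K)" if K: "\<forall>S\<in>K. ?P S" for K
  proof (intro conjI ballI)
    show "\<Union>K \<subseteq> X" using K by blast
    fix z assume "z \<in> \<Union>K"
    then obtain S where "S \<in> K" "z \<in> S" by blast
    with K obtain e where "e > 0" "\<forall>y\<in>X. N (y - z) < e \<longrightarrow> y \<in> S" by blast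
    with \<open>S \<in> K\<close> show "\<exists>e>0. \<forall>y\<in>X. N (y - z) < e \<longrightarrow> y \<in> \<Union>K" by blast
  qed
  ultimately have "istopology ?P" unfolding istopology_def by blast
  then show ?thesis by (simp add: quasinorm_topology_def topology_inverse')
qed

definition closed_hyperplane :: "'a::real_vector set \<Rightarrow> ('a \<Rightarrow> real) \<Rightarrow> 'a set \<Rightarrow> bool" where
  "closed_hyperplane X N H \<longleftrightarrow>
     subspace H \<and> closedin (quasinorm_topology X N) H \<and>
     (\<exists>z\<in>X - H. \<forall>y\<in>X. \<exists>h\<in>H. \<exists>c. y = h + c *\<^sub>R z)"

text \<open>Operators on a carrier \<open>X\<close> are total functions on the ambient type of which only the
  values on \<open>X\<close> are constrained.\<close>

definition bounded_operator_on ::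
    "'a::real_vector set \<Rightarrow> ('a \<Rightarrow> real) \<Rightarrow> ('a \<Rightarrow> 'a) \<Rightarrow> bool" where
  "bounded_operator_on X N u \<longleftrightarrow>
     u ` X \<subseteq> X \<and>
     (\<forall>x\<in>X. \<forall>y\<in>X. u (x + y) = u x + u y) \<and>
     (\<forall>c. \<forall>x\<in>X. u (c *\<^sub>R x) = c *\<^sub>R u x) \<and>
     (\<exists>C. \<forall>x\<in>X. N (u x) \<le> C * N x)"

definition complex_structure_on ::
    "'a::real_vector set \<Rightarrow> ('a \<Rightarrow> real) \<Rightarrow> ('a \<Rightarrow> 'a) \<Rightarrow> bool" where
  "complex_structure_on X N u \<longleftrightarrow> bounded_operator_on X N u \<and> (\<forall>x\<in>X. u (u x) = - x)"

definition compatible_with_subspace :: "'a set \<Rightarrow> 'a set \<Rightarrow> ('a \<Rightarrow> 'a) \<Rightarrow> bool" where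
  "compatible_with_subspace Y H u \<longleftrightarrow> u ` (H \<inter> Y) \<subseteq> Y"

end

theory Submission
  imports Defs
begin

text \<open>
  Extend \<open>u\<close> by zero along a vector \<open>z0\<close> outside \<open>H\<close>, chosen in the copy \<open>Y\<close> of the Hilbert space
  unless \<open>H\<close> contains \<open>Y\<close>. The extension \<open>U\<close> leaves \<open>Y\<close> invariant, so it induces operators \<open>\<alpha>\<close> on \<open>Y\<close>
  and \<open>\<beta>\<close> on the quotient, both acting on the Hilbert space. One of them squares to \<open>-1\<close>; the other
  one is a complex structure on a hyperplane, extended by zero.

  The difference \<open>\<alpha> - \<beta>\<close> is compact: its norm on vectors vanishing on the first \<open>N\<close> coordinates tends
  to \<open>0\<close>. Otherwise there are disjointly supported unit vectors \<open>x_1, ..., x_n\<close> with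
  \<open>(\<alpha> - \<beta>) x_i\<close> bounded below and \<open>\<beta> x_i\<close> almost disjointly supported. On sums of \<open>n\<close> such vectors the
  Kalton--Peck map deviates from additivity by \<open>- ln (sqrt n)\<close> times the sum, so the boundedness of \<open>U\<close>
  forces \<open>ln (sqrt n) * norm (\<Sum> \<plusminus>(\<alpha> - \<beta>) x_i) = O(sqrt n)\<close> for suitable signs, while these signs
  make the sum at least of order \<open>sqrt n\<close>.

  Finally, a complex structure \<open>J\<close> on a space and a complex structure \<open>P\<close> on a hyperplane cannot differ
  by a compact operator: \<open>1 - J P\<close> would be a complex-linear Fredholm operator from \<open>P\<close> to \<open>J\<close>, hence of even
  real index, but it is a compact perturbation of twice the inclusion of the hyperplane, which has
  index \<open>-1\<close>.
\<close>

section \<open>The Hilbert space of square-summable sequences\<close>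

lemma ell2_summable_mult:
  assumes "x \<in> ell2" "y \<in> ell2"
  shows "summable (\<lambda>i. x i * y i)"
proof (rule summable_comparison_test')
  show "summable (\<lambda>i. (x i)\<^sup>2 + (y i)\<^sup>2)"
    using assms by (auto simp: ell2_def intro: summable_add)
  show "norm (x i * y i) \<le> (x i)\<^sup>2 + (y i)\<^sup>2" for i
    using sum_squares_bound[of "\<bar>x i\<bar>" "\<bar>y i\<bar>"] abs_ge_zero[of "x i * y i"]
    unfolding real_norm_def abs_mult power2_abs by linarith
qed

lemma ell2_zero: "0 \<in> ell2"
  by (simp add: ell2_def zero_fun_def)

lemma ell2_add:
  assumes "x \<in> ell2" "y \<in> ell2"
  shows "x + y \<in> ell2"
proof -
  have "(\<lambda>i. ((x + y) i)\<^sup>2) = (\<lambda>i. (x i)\<^sup>2 + (y i)\<^sup>2 + 2 * (x i * y i))"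
    by (auto simp: plus_fun_def power2_sum)
  moreover have "summable (\<lambda>i. (x i)\<^sup>2 + (y i)\<^sup>2 + 2 * (x i * y i))"
    using assms ell2_summable_mult[OF assms]
    by (intro summable_add summable_mult) (auto simp: ell2_def)
  ultimately show ?thesis by (simp add: ell2_def)
qed

lemma ell2_scaleR: "x \<in> ell2 \<Longrightarrow> c *\<^sub>R x \<in> ell2"
  by (simp add: ell2_def scaleR_fun_def power_mult_distrib summable_mult)

lemma ell2_uminus: "x \<in> ell2 \<Longrightarrow> - x \<in> ell2"
  by (simp add: ell2_def)

lemma ell2_diff: "x \<in> ell2 \<Longrightarrow> y \<in> ell2 \<Longrightarrow> x - y \<in> ell2"
  using ell2_add[of x "- y"] ell2_uminus[of y] by simp

lemma ell2_dominated:
  assumes "y \<in> ell2" "\<And>i. \<bar>x i\<bar> \<le> \<bar>y i\<bar>"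
  shows "x \<in> ell2"
  unfolding ell2_def mem_Collect_eq
proof (rule summable_comparison_test')
  show "summable (\<lambda>i. (y i)\<^sup>2)" using assms by (simp add: ell2_def)
  show "norm ((x i)\<^sup>2) \<le> (y i)\<^sup>2" for i using assms(2)[of i] by (simp add: abs_le_square_iff)
qed

text \<open>The Hilbert space of square-summable sequences as a type, so that the library's
  inner product and Banach space theory applies.\<close>

typedef l2 = ell2
  morphisms coord Abs_l2
  using ell2_zero by blast

setup_lifting type_definition_l2

lemma coord_ell2 [simp]: "coord x \<in> ell2"
  by (rule coord)

instantiation l2 :: real_vector
begin

lift_definition zero_l2 :: l2 is 0 by (rule ell2_zero)
lift_definition plus_l2 :: "l2 \<Rightarrow> l2 \<Rightarrow> l2" is "(+)" by (rule ell2_add)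
lift_definition minus_l2 :: "l2 \<Rightarrow> l2 \<Rightarrow> l2" is "(-)" by (rule ell2_diff)
lift_definition uminus_l2 :: "l2 \<Rightarrow> l2" is uminus by (rule ell2_uminus)
lift_definition scaleR_l2 :: "real \<Rightarrow> l2 \<Rightarrow> l2" is scaleR by (rule ell2_scaleR)

instance
proof
  fix a b c :: l2 and r s :: real
  show "a + b + c = a + (b + c)" by transfer (simp add: add.assoc)
  show "a + b = b + a" by transfer (simp add: add.commute)
  show "0 + a = a" by transfer simp
  show "- a + a = 0" by transfer simp
  show "a - b = a + - b" by transfer simp
  show "r *\<^sub>R (a + b) = r *\<^sub>R a + r *\<^sub>R b" by transfer (simp add: scaleR_add_right)
  show "(r + s) *\<^sub>R a = r *\<^sub>R a + s *\<^sub>R a" by transfer (simp add: scaleR_add_left)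
  show "r *\<^sub>R s *\<^sub>R a = (r * s) *\<^sub>R a" by transfer simp
  show "1 *\<^sub>R a = a" by transfer simp
qed

end

instantiation l2 :: real_inner
begin

lift_definition inner_l2 :: "l2 \<Rightarrow> l2 \<Rightarrow> real" is "\<lambda>x y. \<Sum>i. x i * y i" .
definition norm_l2 :: "l2 \<Rightarrow> real" where "norm_l2 x = sqrt (inner x x)"
definition dist_l2 :: "l2 \<Rightarrow> l2 \<Rightarrow> real" where "dist_l2 x y = norm (x - y)"
definition sgn_l2 :: "l2 \<Rightarrow> l2" where "sgn_l2 x = x /\<^sub>R norm x"
definition uniformity_l2 :: "(l2 \<times> l2) filter" where
  "uniformity_l2 = (INF e\<in>{0<..}. principal {(x, y). dist x y < e})"
definition open_l2 :: "l2 set \<Rightarrow> bool" where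
  "open_l2 U \<longleftrightarrow> (\<forall>x\<in>U. eventually (\<lambda>(x', y). x' = x \<longrightarrow> y \<in> U) uniformity)"

instance
proof
  fix a b c :: l2 and r :: real
  show "dist a b = norm (a - b)" by (rule dist_l2_def)
  show "sgn a = a /\<^sub>R norm a" by (rule sgn_l2_def)
  show "uniformity = (INF e\<in>{0<..}. principal {(x, y :: l2). dist x y < e})"
    by (rule uniformity_l2_def)
  show "open U \<longleftrightarrow> (\<forall>x\<in>U. eventually (\<lambda>(x', y). x' = x \<longrightarrow> y \<in> U) uniformity)" for U :: "l2 set"
    by (rule open_l2_def)
  show "inner a b = inner b a" by transfer (simp add: mult.commute)
  show "inner (a + b) c = inner a c + inner b c"
    by transfer (simp add: ring_distribs suminf_add ell2_summable_mult)
  show "inner (r *\<^sub>R a) b = r * inner a b"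
    by transfer (simp add: scaleR_fun_def suminf_mult ell2_summable_mult mult.assoc)
  show "0 \<le> inner a a"
    by transfer (simp add: suminf_nonneg ell2_summable_mult)
  show "inner a a = 0 \<longleftrightarrow> a = 0"
    by transfer (simp add: suminf_eq_zero_iff ell2_summable_mult fun_eq_iff)
  show "norm a = sqrt (inner a a)" by (rule norm_l2_def)
qed

end

lemma coord_simps [simp]:
  "coord 0 = 0" "coord (x + y) = coord x + coord y" "coord (x - y) = coord x - coord y"
  "coord (- x) = - coord x" "coord (c *\<^sub>R x) = c *\<^sub>R coord x"
  by (transfer, simp)+

lemma coord_sum: "coord (sum f A) = (\<Sum>i\<in>A. coord (f i))"
  by (induction A rule: infinite_finite_induct) auto

lemma coord_sum_at: "coord (sum f A) i = (\<Sum>j\<in>A. coord (f j) i)"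
  by (induction A rule: infinite_finite_induct) auto

lemma ell2_norm_coord: "ell2_norm (coord x) = norm x"
  unfolding ell2_norm_def norm_l2_def by transfer (simp add: power2_eq_square)

lemma norm_l2_power2: "(norm x)\<^sup>2 = (\<Sum>i. (coord x i)\<^sup>2)"
  by (simp only: power2_norm_eq_inner inner_l2.rep_eq) (simp add: power2_eq_square)

lemma summable_coord_power2: "summable (\<lambda>i. (coord x i)\<^sup>2)"
  using coord_ell2[of x] by (simp add: ell2_def)

lemma abs_coord_le_norm: "\<bar>coord x i\<bar> \<le> norm x"
proof -
  have "(\<Sum>j\<in>{i}. (coord x j)\<^sup>2) \<le> (norm x)\<^sup>2"
    unfolding norm_l2_power2 by (rule sum_le_suminf) (auto simp: summable_coord_power2)
  then show ?thesis by (simp add: abs_le_square_iff[of "coord x i" "norm x", simplified])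
qed

lemma norm_le_coord:
  assumes "\<And>i. \<bar>coord x i\<bar> \<le> \<bar>coord y i\<bar>"
  shows "norm x \<le> norm y"
proof -
  have "(norm x)\<^sup>2 \<le> (norm y)\<^sup>2"
    unfolding norm_l2_power2
    by (rule suminf_le) (use assms in \<open>auto simp: summable_coord_power2 abs_le_square_iff\<close>)
  then show ?thesis by (simp add: power2_le_iff_abs_le)
qed

lemma ell2_of_bounded_sums:
  assumes "\<And>k. (\<Sum>i<k. (x i)\<^sup>2) \<le> C"
  shows "x \<in> ell2" "(\<Sum>i. (x i)\<^sup>2) \<le> C"
proof -
  have s: "summable (\<lambda>i. (x i)\<^sup>2)"
    using assms by (intro summableI_nonneg_bounded) auto
  then show "x \<in> ell2" by (simp add: ell2_def)
  show "(\<Sum>i. (x i)\<^sup>2) \<le> C" using s assms by (rule suminf_le_const)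
qed

text \<open>Coordinatewise limits give the candidate. Bounds on finite partial sums survive the
  passage to the limit, which yields both its square-summability and convergence in norm.\<close>

instance l2 :: complete_space
proof
  fix X :: "nat \<Rightarrow> l2" assume X: "Cauchy X"
  have "Cauchy (\<lambda>n. coord (X n) i)" for i
  proof (rule metric_CauchyI)
    fix e :: real assume "e > 0"
    then obtain M where M: "\<And>m n. m \<ge> M \<Longrightarrow> n \<ge> M \<Longrightarrow> dist (X m) (X n) < e"
      using metric_CauchyD[OF X] by blast
    have "dist (coord (X m) i) (coord (X n) i) \<le> dist (X m) (X n)" for m n
      using abs_coord_le_norm[of "X m - X n" i] by (simp add: dist_norm)
    with M show "\<exists>M. \<forall>m\<ge>M. \<forall>n\<ge>M. dist (coord (X m) i) (coord (X n) i) < e"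
      by (meson le_less_trans)
  qed
  then obtain L where L: "\<And>i. (\<lambda>n. coord (X n) i) \<longlonglongrightarrow> L i"
    unfolding Cauchy_convergent_iff convergent_def by metis
  \<comment> \<open>Stated for the difference because \<open>L\<close> is not yet known to be
    square-summable; the case \<open>e = 1\<close> supplies that afterwards.\<close>
  have key: "\<exists>M. \<forall>m\<ge>M. coord (X m) - L \<in> ell2 \<and> (\<Sum>i. ((coord (X m) - L) i)\<^sup>2) \<le> e\<^sup>2"
    if "e > 0" for e :: real
  proof -
    obtain M where M: "\<And>m n. m \<ge> M \<Longrightarrow> n \<ge> M \<Longrightarrow> dist (X m) (X n) < e"
      using metric_CauchyD[OF X \<open>e > 0\<close>] by blast
    have "(\<Sum>i<k. ((coord (X m) - L) i)\<^sup>2) \<le> e\<^sup>2" if "m \<ge> M" for m k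
    proof (rule LIMSEQ_le_const2)
      show "(\<lambda>n. \<Sum>i<k. (coord (X m) i - coord (X n) i)\<^sup>2)
          \<longlonglongrightarrow> (\<Sum>i<k. ((coord (X m) - L) i)\<^sup>2)"
        unfolding fun_diff_def by (intro tendsto_intros L)
      have "(\<Sum>i<k. (coord (X m) i - coord (X n) i)\<^sup>2) \<le> e\<^sup>2" if "n \<ge> M" for n
      proof -
        have "(\<Sum>i<k. (coord (X m - X n) i)\<^sup>2) \<le> (norm (X m - X n))\<^sup>2"
          unfolding norm_l2_power2 by (rule sum_le_suminf[OF summable_coord_power2]) auto
        also have "\<dots> \<le> e\<^sup>2"
          using M[OF \<open>m \<ge> M\<close> that] by (intro power_mono) (auto simp: dist_norm)
        finally show ?thesis by simp
      qed
      then show "\<exists>N. \<forall>n\<ge>N. (\<Sum>i<k. (coord (X m) i - coord (X n) i)\<^sup>2) \<le> e\<^sup>2" by blast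
    qed
    then show ?thesis using ell2_of_bounded_sums by blast
  qed
  from key[of 1] obtain m where "coord (X m) - L \<in> ell2" by auto
  from ell2_diff[OF coord_ell2[of "X m"] this] have "L \<in> ell2" by simp
  then have cL: "coord (Abs_l2 L) = L" by (simp add: Abs_l2_inverse)
  have "X \<longlonglongrightarrow> Abs_l2 L"
  proof (rule metric_LIMSEQ_I)
    fix r :: real assume "r > 0"
    then obtain M where M: "\<And>m. m \<ge> M \<Longrightarrow> (\<Sum>i. ((coord (X m) - L) i)\<^sup>2) \<le> (r / 2)\<^sup>2"
      using key[of "r / 2"] by auto
    have "dist (X m) (Abs_l2 L) < r" if "m \<ge> M" for m
    proof -
      have "(norm (X m - Abs_l2 L))\<^sup>2 \<le> (r / 2)\<^sup>2"
        unfolding norm_l2_power2 using M[OF that] by (simp add: cL)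
      then have "norm (X m - Abs_l2 L) \<le> r / 2"
        by (rule power2_le_imp_le) (use \<open>r > 0\<close> in simp)
      then show ?thesis using \<open>r > 0\<close> by (simp add: dist_norm)
    qed
    then show "\<exists>no. \<forall>n\<ge>no. dist (X n) (Abs_l2 L) < r" by blast
  qed
  then show "convergent X" by (auto simp: convergent_def)
qed

instance l2 :: banach ..

section \<open>Truncations, unit vectors and representation of functionals\<close>

lift_definition restrict_l2 :: "nat set \<Rightarrow> l2 \<Rightarrow> l2" is "\<lambda>S x i. if i \<in> S then x i else 0"
  by (erule ell2_dominated) auto

lemma coord_restrict_l2: "coord (restrict_l2 S x) i = (if i \<in> S then coord x i else 0)"
  by transfer simp

lemma l2_eqI: "(\<And>i. coord x i = coord y i) \<Longrightarrow> x = y"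
  by transfer auto

lemma norm_restrict_l2_le: "norm (restrict_l2 S x) \<le> norm x"
  by (rule norm_le_coord) (auto simp: coord_restrict_l2)

lemma bounded_linear_restrict_l2: "bounded_linear (restrict_l2 S)"
  by (rule bounded_linear_intro[where K = 1])
    (auto intro!: l2_eqI simp: coord_restrict_l2 norm_restrict_l2_le scaleR_fun_def)

lemma restrict_l2_tendsto: "(\<lambda>n. restrict_l2 {..<n} x) \<longlonglongrightarrow> x"
proof -
  have "(\<lambda>n. (\<Sum>i. (coord x (i + n))\<^sup>2)) \<longlonglongrightarrow> 0"
    using suminf_exist_split2[OF summable_coord_power2[of x]] .
  moreover have "(\<Sum>i. (coord x (i + n))\<^sup>2) = (norm (restrict_l2 {..<n} x - x))\<^sup>2" for n
  proof -
    have "(norm (restrict_l2 {..<n} x - x))\<^sup>2 = (\<Sum>i. (coord (restrict_l2 {..<n} x - x) (i + n))\<^sup>2)"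
      unfolding norm_l2_power2 by (subst suminf_minus_initial_segment[OF summable_coord_power2]) 
        (simp add: coord_restrict_l2)
    then show ?thesis by (simp add: coord_restrict_l2)
  qed
  ultimately have "(\<lambda>n. sqrt ((norm (restrict_l2 {..<n} x - x))\<^sup>2)) \<longlonglongrightarrow> sqrt 0"
    by (intro tendsto_real_sqrt) simp
  then show ?thesis
    by (simp add: LIM_zero_iff tendsto_norm_zero_iff)
qed

lift_definition unit_l2 :: "nat \<Rightarrow> l2" is "\<lambda>i j. if j = i then 1 else 0"
  by (rule ell2_of_bounded_sums[where C = 1])
    (simp add: if_distrib[of "\<lambda>t. t\<^sup>2"] sum.delta cong: if_cong)

lemma restrict_l2_eq_sum: "restrict_l2 {..<n} x = (\<Sum>i<n. coord x i *\<^sub>R unit_l2 i)"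
  by (rule l2_eqI) (simp add: coord_restrict_l2 coord_sum_at unit_l2.rep_eq scaleR_fun_def
      if_distrib[of "\<lambda>t. _ * t"] sum.delta cong: if_cong)

text \<open>Evaluating \<open>f\<close> on the truncated sequence of its own values
  \<open>f (unit_l2 i)\<close> bounds their square sum by \<open>C\<^sup>2\<close>. The vector they
  form represents \<open>f\<close> on truncations, hence everywhere by continuity.\<close>

lemma l2_riesz:
  fixes f :: "l2 \<Rightarrow> real"
  assumes f: "bounded_linear f"
  obtains v where "\<And>x. f x = inner v x"
proof -
  interpret f: bounded_linear f by fact
  obtain C where C: "\<And>x. \<bar>f x\<bar> \<le> norm x * C" "C > 0" using f.pos_bounded by auto
  let ?a = "\<lambda>i. f (unit_l2 i)"
  have "(\<Sum>i<n. (?a i)\<^sup>2) \<le> C\<^sup>2" for n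
  proof -
    let ?v = "\<Sum>i<n. ?a i *\<^sub>R unit_l2 i" and ?s = "\<Sum>i<n. (?a i)\<^sup>2"
    have v: "coord ?v i = (if i < n then ?a i else 0)" for i
      by (simp add: coord_sum_at unit_l2.rep_eq scaleR_fun_def
      if_distrib[of "\<lambda>t. _ * t"] sum.delta cong: if_cong)
    have "(norm ?v)\<^sup>2 = (\<Sum>i. if i \<in> {..<n} then (?a i)\<^sup>2 else 0)"
      unfolding norm_l2_power2 by (simp add: v if_distrib[of "\<lambda>t. t\<^sup>2"] cong: if_cong)
    also have "\<dots> = ?s" by (subst suminf_finite[of "{..<n}"]) auto
    finally have nv: "norm ?v = sqrt ?s" by (metis norm_ge_zero real_sqrt_unique)
    have "f ?v = ?s" by (simp add: f.sum f.scaleR power2_eq_square)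
    then have "?s \<le> sqrt ?s * C" using C(1)[of ?v] nv by simp
    moreover obtain w where w: "w = sqrt ?s" by blast
    moreover have ww: "?s = w * w" "w \<ge> 0" unfolding w by (simp_all add: sum_nonneg)
    ultimately have "w * w \<le> w * C" by metis
    then have "w \<le> C" using ww C(2) by (cases "w = 0") auto
    then have "w * w \<le> C * C" using ww(2) by (intro mult_mono) auto
    then show ?thesis using ww(1) by (simp add: power2_eq_square[of C])
  qed
  then have "?a \<in> ell2" by (rule ell2_of_bounded_sums)
  then have ca: "coord (Abs_l2 ?a) = ?a" by (simp add: Abs_l2_inverse)
  have "f x = inner (Abs_l2 ?a) x" for x
  proof -
    have "f (restrict_l2 {..<n} x) = inner (Abs_l2 ?a) (restrict_l2 {..<n} x)" for n
    proof -
      have "inner (Abs_l2 ?a) (unit_l2 i) = ?a i" for i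
      proof -
        have "inner (Abs_l2 ?a) (unit_l2 i) = (\<Sum>j. if j \<in> {i} then ?a j else 0)"
          by (simp add: inner_l2.rep_eq ca unit_l2.rep_eq if_distrib[of "\<lambda>t. _ * t"] cong: if_cong)
        also have "\<dots> = ?a i" by (subst suminf_finite[of "{i}"]) auto
        finally show ?thesis .
      qed
      then show ?thesis
        by (simp add: restrict_l2_eq_sum f.sum f.scaleR inner_sum_right)
    qed
    moreover have "(\<lambda>n. f (restrict_l2 {..<n} x)) \<longlonglongrightarrow> f x"
      by (intro f.tendsto restrict_l2_tendsto)
    moreover have "(\<lambda>n. inner (Abs_l2 ?a) (restrict_l2 {..<n} x)) \<longlonglongrightarrow> inner (Abs_l2 ?a) x"
      by (intro tendsto_intros restrict_l2_tendsto)
    ultimately show ?thesis using LIMSEQ_unique by fastforce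
  qed
  then show ?thesis by (rule that)
qed

section \<open>Operators that are small on tails\<close>

text \<open>For a bounded linear \<open>T\<close> into a Banach space this is compactness:
  \<open>T\<close> is the norm limit of its compositions with the truncations to the first
  \<open>N\<close> coordinates.\<close>

definition tail_small :: "(l2 \<Rightarrow> 'a::real_normed_vector) \<Rightarrow> bool" where
  "tail_small T \<longleftrightarrow>
     (\<forall>e>0. \<exists>N. \<forall>x. restrict_l2 {..<N} x = 0 \<longrightarrow> norm (T x) \<le> e * norm x)"

lemma restrict_l2_tail:
  "restrict_l2 {..<N} x = 0 \<longleftrightarrow> (\<forall>i<N. coord x i = 0)"
proof
  assume "restrict_l2 {..<N} x = 0"
  then have "coord (restrict_l2 {..<N} x) i = 0" for i by simp
  then show "\<forall>i<N. coord x i = 0" by (metis coord_restrict_l2 lessThan_iff)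
qed (auto intro!: l2_eqI simp: coord_restrict_l2)

text \<open>The representing vector is close in norm to one of its truncations, and that truncation
  is orthogonal to every vector vanishing on the first \<open>N\<close> coordinates.\<close>

lemma tail_small_functional:
  fixes f :: "l2 \<Rightarrow> real"
  assumes "bounded_linear f"
  shows "tail_small f"
  unfolding tail_small_def
proof (intro allI impI)
  fix e :: real assume "e > 0"
  obtain v where v: "\<And>x. f x = inner v x" using l2_riesz[OF assms] by blast
  from LIMSEQ_D[OF restrict_l2_tendsto[of v] \<open>e > 0\<close>] obtain N
    where N: "norm (restrict_l2 {..<N} v - v) < e" by blast
  have "norm (f x) \<le> e * norm x" if x: "restrict_l2 {..<N} x = 0" for x
  proof -
    have "inner (restrict_l2 {..<N} v) x = (\<Sum>i. coord (restrict_l2 {..<N} v) i * coord x i)"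
      by (simp add: inner_l2.rep_eq)
    also have "\<dots> = (\<Sum>i. 0)"
      using x unfolding restrict_l2_tail by (intro suminf_cong) (simp add: coord_restrict_l2)
    finally have "f x = inner (v - restrict_l2 {..<N} v) x" by (simp add: v inner_diff_left)
    then have "norm (f x) \<le> norm (v - restrict_l2 {..<N} v) * norm x"
      using Cauchy_Schwarz_ineq2 by simp
    also have "\<dots> \<le> e * norm x"
      using N by (intro mult_right_mono) (auto simp: norm_minus_commute)
    finally show ?thesis .
  qed
  then show "\<exists>N. \<forall>x. restrict_l2 {..<N} x = 0 \<longrightarrow> norm (f x) \<le> e * norm x" by blast
qed

section \<open>Parity of dimensions under complex structures\<close>

text \<open>A common element has an expansion in \<open>B\<close> supported in \<open>C\<close> and
  another supported in \<open>B - C\<close>; uniqueness makes all coefficients vanish.\<close>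

lemma span_Int_span_Diff:
  fixes B :: "'a::real_vector set"
  assumes "independent B" "C \<subseteq> B"
  shows "span C \<inter> span (B - C) = {0}"
proof -
  have "x = 0" if x: "x \<in> span C" "x \<in> span (B - C)" for x
  proof -
    have "x \<in> span B" using x(1) assms(2) span_mono by blast
    have "representation B x b = 0" for b
    proof -
      have "representation B x = representation C x" "representation B x = representation (B - C) x"
        using assms x by (auto intro: real_vector.representation_extend)
      then show ?thesis
        using real_vector.representation_ne_zero by (metis Diff_iff)
    qed
    then show ?thesis
      using real_vector.sum_nonzero_representation_eq[OF assms(1) \<open>x \<in> span B\<close>] by simp
  qed
  then show ?thesis using span_zero by blast
qed

lemma dim_zero_subspace: "dim {0 :: 'a::real_vector} = 0"
  using basis_card_eq_dim[of "{}" "{0 :: 'a}"] real_vector.independent_empty by simp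

text \<open>The ambient space may be infinite-dimensional; the finite set \<open>C\<close> keeps
  \<open>dim\<close> meaningful on \<open>W\<close>. A basis of the kernel is extended to one of
  \<open>W\<close>, and \<open>f\<close> is injective on the span of the added vectors.\<close>

lemma rank_nullity_subspace:
  fixes f :: "'a::real_vector \<Rightarrow> 'b::real_vector"
  assumes f: "linear f" and W: "subspace W" "W \<subseteq> span C" "finite C"
  shows "dim W = dim {x\<in>W. f x = 0} + dim (f ` W)"
proof -
  let ?N = "{x\<in>W. f x = 0}"
  obtain B0 where B0: "B0 \<subseteq> ?N" "independent B0" "?N \<subseteq> span B0"
    using maximal_independent_subset by blast
  then have "B0 \<subseteq> W" by blast
  from maximal_independent_subset_extend[OF this B0(2)] obtain B
    where B: "B0 \<subseteq> B" "B \<subseteq> W" "independent B" "W \<subseteq> span B" by blast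
  have fin: "finite B"
    using independent_span_bound[OF W(3) B(3)] B(2) W(2) by blast
  have spanB: "span B = W"
    using B W(1) by (metis span_minimal subset_antisym)
  have inj: "inj_on f (span (B - B0))"
    unfolding linear_inj_on_iff_eq_0[OF f subspace_span]
  proof (intro ballI impI)
    fix x assume x: "x \<in> span (B - B0)" "f x = 0"
    then have "x \<in> W" using spanB span_mono[of "B - B0" B] by blast
    then have "x \<in> span B0" using x B0(3) by blast
    then show "x = 0" using x span_Int_span_Diff[OF B(3,1)] by blast
  qed
  have ind: "independent (B - B0)" using B(3) independent_mono by blast
  have "card (f ` (B - B0)) = card (B - B0)"
    using inj span_superset by (metis card_image inj_on_subset)
  moreover have "card (f ` (B - B0)) = dim (f ` W)"
  proof (rule basis_card_eq_dim)
    show "f ` (B - B0) \<subseteq> f ` W" using B(2) by blast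
    show "independent (f ` (B - B0))"
      using linear_independent_injective_image[OF f ind inj] .
    have "f b \<in> span (f ` (B - B0))" if "b \<in> B" for b
    proof (cases "b \<in> B0")
      case True
      then show ?thesis using B0(1) by (auto simp: span_zero)
    next
      case False
      then show ?thesis using that by (auto intro: span_base)
    qed
    then have "span (f ` B) \<subseteq> span (f ` (B - B0))"
      by (intro span_minimal) auto
    then show "f ` W \<subseteq> span (f ` (B - B0))"
      using linear_span_image[OF f, of B] spanB by simp
  qed
  moreover have "card B0 = dim ?N" using B0 by (intro basis_card_eq_dim) auto
  moreover have "card B = dim W" using B by (intro basis_card_eq_dim) auto
  moreover have "card B = card B0 + card (B - B0)"
    using B(1) fin by (metis card_Diff_subset card_mono finite_subset le_add_diff_inverse)
  ultimately show ?thesis by simp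
qed

text \<open>Adding \<open>x\<close> and \<open>J x\<close> for some \<open>x\<close> outside the span keeps the span invariant and raises
  the dimension by two.\<close>

lemma complex_structure_extend_basis:
  fixes J :: "'a::real_vector \<Rightarrow> 'a"
  assumes J: "linear J" and V: "subspace V" "V \<subseteq> span C" "finite C" "J ` V \<subseteq> V"
    and sq: "\<And>x. x \<in> V \<Longrightarrow> J (J x) = - x"
    and B: "independent B" "B \<subseteq> V" "J ` span B \<subseteq> span B"
  shows "\<exists>B'. independent B' \<and> B' \<subseteq> V \<and> V \<subseteq> span B' \<and> even (card B + card B')"
  using B
proof (induction "card C - card B" arbitrary: B rule: less_induct)
  case (less B)
  interpret J: linear J by fact
  show ?case
  proof (cases "V \<subseteq> span B")
    case True
    then show ?thesis using less.prems by auto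
  next
    case False
    then obtain x where x: "x \<in> V" "x \<notin> span B" by blast
    have Jx: "J x \<in> V" using x V(4) by blast
    \<comment> \<open>Modulo the span of \<open>B\<close>, \<open>J\<close> squares to
      \<open>-1\<close> and so has no real eigenvalue: a relation with coefficient \<open>a\<close>
      would put \<open>- (1 + a * a) *\<^sub>R x\<close> into the span.\<close>
    have notin: "J x \<notin> span (insert x B)"
    proof
      assume "J x \<in> span (insert x B)"
      then obtain a where a: "J x - a *\<^sub>R x \<in> span B" by (auto simp: span_insert)
      then have "J (J x - a *\<^sub>R x) \<in> span B" using less.prems(3) by blast
      then have "- x - a *\<^sub>R J x \<in> span B" using sq[OF x(1)] by (simp add: J.diff J.scale)
      from span_add[OF this span_scale[OF a, of a]]
      have "- x - a *\<^sub>R J x + a *\<^sub>R (J x - a *\<^sub>R x) \<in> span B" .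
      moreover have "- x - a *\<^sub>R J x + a *\<^sub>R (J x - a *\<^sub>R x) = - (1 + a * a) *\<^sub>R x"
        by (simp add: algebra_simps)
      ultimately have m: "- (1 + a * a) *\<^sub>R x \<in> span B" by simp
      have nz: "- (1 + a * a) \<noteq> 0" by (smt (verit) zero_le_square)
      have "(inverse (- (1 + a * a))) *\<^sub>R (- (1 + a * a) *\<^sub>R x) = x"
        unfolding scaleR_scaleR using left_inverse[OF nz] by simp
      with span_scale[OF m, of "inverse (- (1 + a * a))"] have "x \<in> span B" by simp
      then show False using x by blast
    qed
    let ?B = "insert (J x) (insert x B)"
    have i1: "independent (insert x B)" using x less.prems(1) by (intro independent_insertI)
    have i2: "independent ?B" by (rule independent_insertI[OF notin i1])
    have BV: "?B \<subseteq> V" using x Jx less.prems(2) by blast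
    have finB: "finite B" and cC: "card ?B \<le> card C"
      using independent_span_bound[OF V(3) i2] BV V(2) by auto
    have "x \<notin> B" using x(2) span_base by metis
    moreover have "J x \<notin> insert x B" using notin span_base by metis
    ultimately have card: "card ?B = card B + 2" using finB by simp
    have "J ` span ?B \<subseteq> span ?B"
    proof -
      have "J b \<in> span ?B" if b: "b \<in> ?B" for b
      proof -
        consider "b = x" | "b = J x" | "b \<in> B" using b by blast
        then show ?thesis
        proof cases
          case 1
          then show ?thesis by (auto intro: span_base)
        next
          case 2
          then show ?thesis using sq[OF x(1)] by (auto intro: span_neg span_base)
        next
          case 3
          then have "J b \<in> span B" using less.prems(3) span_base by blast
          then show ?thesis using span_mono[of B ?B] by blast
        qed
      qed
      then have "span (J ` ?B) \<subseteq> span ?B" by (intro span_minimal) auto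
      then show ?thesis by (simp only: linear_span_image[OF J, of ?B])
    qed
    moreover have "card C - card ?B < card C - card B" using card cC by simp
    ultimately obtain B'
      where "independent B'" "B' \<subseteq> V" "V \<subseteq> span B'" "even (card ?B + card B')"
      using less.hyps[OF _ i2 BV] by blast
    then show ?thesis using card by auto
  qed
qed

text \<open>A basis of \<open>M\<close> extends to one of \<open>V\<close> two vectors at a time, so
  the codimension is even. The sum avoids truncated subtraction, and \<open>M = {0}\<close> gives
  the parity of \<open>dim V\<close> itself.\<close>

lemma even_dim_add_invariant_subspace:
  fixes J :: "'a::real_vector \<Rightarrow> 'a"
  assumes J: "linear J" and V: "subspace V" "V \<subseteq> span C" "finite C" "J ` V \<subseteq> V"
    and sq: "\<And>x. x \<in> V \<Longrightarrow> J (J x) = - x"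
    and M: "subspace M" "M \<subseteq> V" "J ` M \<subseteq> M"
  shows "even (dim M + dim V)"
proof -
  obtain B where B: "B \<subseteq> M" "independent B" "M \<subseteq> span B" "card B = dim M"
    using basis_exists by blast
  then have "span B = M" using M(1) by (metis span_minimal subset_antisym)
  then obtain B' where "independent B'" "B' \<subseteq> V" "V \<subseteq> span B'" "even (card B + card B')"
    using complex_structure_extend_basis[OF J V sq B(2)] B(1) M by auto
  then show ?thesis using B(4) basis_card_eq_dim[of B' V] by simp
qed

text \<open>\<open>A\<close> is a finite rank perturbation of an invertible operator and hence of index zero, while
  \<open>J\<close> makes the codimension of its range even.\<close>

lemma even_dim_kernel_of_invariant_range:
  fixes A S F J :: "'a::banach \<Rightarrow> 'a"
  assumes S: "bounded_linear S" "\<And>x. norm (S x) \<le> norm x"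
    and F: "linear F" "range F \<subseteq> span C" "finite C"
    and J: "linear J" "\<And>x. J (J x) = - x"
    and A: "\<And>x. A x = 2 *\<^sub>R x + S x + F x"
    and inv: "J ` range A \<subseteq> range A"
  shows "even (dim {x. A x = 0})" "\<exists>D. finite D \<and> {x. A x = 0} \<subseteq> span D"
proof -
  interpret S: bounded_linear S by fact
  interpret F: linear F by fact
  interpret J: linear J by fact
  define T where "T x = 2 *\<^sub>R x + S x" for x
  have linT: "linear T"
    by (rule linearI) (simp_all add: T_def S.add S.scaleR algebra_simps)
  interpret T: linear T by fact
  have linA: "linear A"
    by (rule linearI) (simp_all add: A S.add S.scaleR F.add F.scale algebra_simps)
  \<comment> \<open>\<open>T\<close> is twice the identity plus an operator of norm at most one, so
    solving \<open>T x = y\<close> is a fixed-point problem for a contraction with constant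
    \<open>1/2\<close>.\<close>
  have ex1: "\<exists>!x. T x = y" for y
  proof -
    have "\<exists>!x. (1/2) *\<^sub>R (y - S x) = x"
    proof (rule banach_fix_type[where c = "1/2"])
      have "norm (S x' - S x) \<le> norm (x' - x)" for x x'
        using S(2)[of "x' - x"] by (simp add: S.diff)
      then have "dist ((1/2) *\<^sub>R (y - S x)) ((1/2) *\<^sub>R (y - S x')) \<le> 1/2 * dist x x'" for x x'
        by (simp add: dist_norm flip: scaleR_diff_right) (metis norm_minus_commute)
      then show "\<forall>x x'. dist ((1/2) *\<^sub>R (y - S x)) ((1/2) *\<^sub>R (y - S x')) \<le> 1/2 * dist x x'"
        by blast
    qed auto
    moreover have "(1/2) *\<^sub>R (y - S x) = x \<longleftrightarrow> T x = y" for x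
    proof -
      have "(1/2) *\<^sub>R (y - S x) = x \<longleftrightarrow> 2 *\<^sub>R ((1/2) *\<^sub>R (y - S x)) = 2 *\<^sub>R x"
        by (subst scaleR_cancel_left) simp
      then show ?thesis by (auto simp: T_def algebra_simps)
    qed
    ultimately show ?thesis by simp
  qed
  then have bij: "bij T" by (metis bij_iff)
  have linI: "linear (inv T)"
  proof -
    obtain g where g: "linear g" "g \<circ> T = id"
      using linear_injective_left_inverse[OF linT bij_is_inj[OF bij]] by blast
    have "g y = inv T y" for y
      using g(2) bij by (metis bij_inv_eq_iff comp_apply id_apply)
    then have "g = inv T" by blast
    then show ?thesis using g(1) by simp
  qed
  \<comment> \<open>Adding the \<open>J\<close>-images makes the span \<open>R\<close> invariant
    under \<open>J\<close> while it still contains the range of \<open>F\<close>.\<close>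
  let ?C = "C \<union> J ` C"
  define R where "R = span ?C"
  define W where "W = {x. T x \<in> R}"
  have finC: "finite ?C" using F(3) by simp
  have subR: "subspace R" by (simp add: R_def)
  have FR: "F x \<in> R" for x
    using F(2) span_mono[of C ?C] unfolding R_def by blast
  have JR: "J ` R \<subseteq> R"
  proof -
    have base: "c \<in> span ?C" "J c \<in> span ?C" if "c \<in> C" for c
      using that by (auto intro: span_base)
    then have "- c \<in> span ?C" if "c \<in> C" for c
      using that by (intro span_neg)
    with base have "J ` ?C \<subseteq> span ?C" by (auto simp: J)
    then have "span (J ` ?C) \<subseteq> span ?C" by (intro span_minimal) auto
    then show ?thesis unfolding R_def by (simp only: linear_span_image[OF J(1), of ?C])
  qed
  \<comment> \<open>\<open>A\<close> and \<open>T\<close> differ by \<open>F\<close>, whose values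
    lie in \<open>R\<close>, so \<open>W\<close> is the preimage of \<open>R\<close> under either.
    It therefore contains the kernel of \<open>A\<close>, and the index count reduces to
    \<open>A\<close> from \<open>W\<close> to \<open>R\<close>, spaces of equal finite
    dimension.\<close>
  have AR: "A x \<in> R \<longleftrightarrow> x \<in> W" for x
  proof -
    have "A x = T x + F x" by (simp add: A T_def)
    then show ?thesis using FR[of x] subR unfolding W_def
      by (metis add_diff_cancel_right' mem_Collect_eq subspace_add subspace_diff)
  qed
  have subW: "subspace W"
    unfolding W_def using linear_subspace_vimage[OF linT subR] by (simp add: vimage_def)
  have WI: "W = inv T ` R"
    using bij unfolding W_def by (metis bij_vimage_eq_inv_image vimage_def)
  then have WC: "W = span (inv T ` ?C)"
    unfolding R_def by (simp only: linear_span_image[OF linI, of ?C])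
  have finTC: "finite (inv T ` ?C)" using finC by simp
  have TW: "T ` W = R"
    using bij unfolding WI by (simp add: image_comp comp_def bij_is_surj surj_f_inv_f)
  have T0: "{x \<in> W. T x = 0} = {0}"
    using ex1[of 0] subW T.zero by (auto simp: subspace_0)
  have dimW: "dim W = dim R"
    using rank_nullity_subspace[OF linT subW, of "inv T ` ?C"] WC finTC TW T0
    by (simp add: dim_zero_subspace)
  have ker: "{x \<in> W. A x = 0} = {x. A x = 0}"
    using AR subspace_0[OF subR] by (auto simp: AR[symmetric])
  have "dim W = dim {x. A x = 0} + dim (A ` W)"
    using rank_nullity_subspace[OF linA subW, of "inv T ` ?C"] WC finTC ker by simp
  moreover have "even (dim (A ` W) + dim R)"
  proof (rule even_dim_add_invariant_subspace[OF J(1) subR])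
    show "R \<subseteq> span ?C" by (simp add: R_def)
    show "subspace (A ` W)" using linA subW by (rule linear_subspace_image)
    show "A ` W \<subseteq> R" using AR by blast
    \<comment> \<open>Invariance of the full range provides a preimage \<open>w'\<close>; as the
      image lies in \<open>R\<close>, that preimage lies in \<open>W\<close>.\<close>
    show "J ` A ` W \<subseteq> A ` W"
    proof clarify
      fix w assume "w \<in> W"
      then have "J (A w) \<in> R" using AR JR by blast
      moreover obtain w' where "J (A w) = A w'" using inv by blast
      ultimately show "J (A w) \<in> A ` W" using AR by auto
    qed
  qed (use finC JR J in auto)
  ultimately show "even (dim {x. A x = 0})" using dimW by (metis even_add)
  show "\<exists>D. finite D \<and> {x. A x = 0} \<subseteq> span D"
    using ker WC finTC by blast
qed

section \<open>Closure properties of tail-smallness\<close>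

lemma tail_small_scaleR_functional:
  fixes f :: "l2 \<Rightarrow> real"
  assumes "bounded_linear f"
  shows "tail_small (\<lambda>x. f x *\<^sub>R v)"
  unfolding tail_small_def
proof (intro allI impI)
  fix e :: real assume "e > 0"
  \<comment> \<open>The added \<open>1\<close> covers \<open>v = 0\<close>.\<close>
  then have "e / (norm v + 1) > 0" by (simp add: add_nonneg_pos)
  then obtain N where N: "\<And>x. restrict_l2 {..<N} x = 0 \<Longrightarrow> norm (f x) \<le> e / (norm v + 1) * norm x"
    using tail_small_functional[OF assms] unfolding tail_small_def by blast
  have "norm (f x *\<^sub>R v) \<le> e * norm x" if "restrict_l2 {..<N} x = 0" for x
  proof -
    have "norm (f x *\<^sub>R v) \<le> (e / (norm v + 1) * norm x) * (norm v + 1)"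
      unfolding norm_scaleR using N[OF that] by (intro mult_mono) auto
    also have "\<dots> = e * norm x" by (simp add: add_nonneg_eq_0_iff)
    finally show ?thesis .
  qed
  then show "\<exists>N. \<forall>x. restrict_l2 {..<N} x = 0 \<longrightarrow> norm (f x *\<^sub>R v) \<le> e * norm x" by blast
qed

lemma restrict_l2_tail_mono:
  "restrict_l2 {..<N} x = 0 \<Longrightarrow> M \<le> N \<Longrightarrow> restrict_l2 {..<M} x = 0"
  by (auto simp: restrict_l2_tail)

lemma tail_small_add:
  assumes "tail_small S" "tail_small T"
  shows "tail_small (\<lambda>x. S x + T x)"
  unfolding tail_small_def
proof (intro allI impI)
  fix e :: real assume "e > 0"
  then have "e / 2 > 0" by simp
  obtain M N where M: "\<And>x. restrict_l2 {..<M} x = 0 \<Longrightarrow> norm (S x) \<le> e / 2 * norm x"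
    and N: "\<And>x. restrict_l2 {..<N} x = 0 \<Longrightarrow> norm (T x) \<le> e / 2 * norm x"
    using assms \<open>e / 2 > 0\<close> unfolding tail_small_def by meson
  have "norm (S x + T x) \<le> e * norm x" if "restrict_l2 {..<max M N} x = 0" for x
  proof -
    have "norm (S x) \<le> e / 2 * norm x" "norm (T x) \<le> e / 2 * norm x"
      using M N restrict_l2_tail_mono[OF that] by simp_all
    then show ?thesis using norm_triangle_ineq[of "S x" "T x"] by (simp add: field_simps)
  qed
  then show "\<exists>N. \<forall>x. restrict_l2 {..<N} x = 0 \<longrightarrow> norm (S x + T x) \<le> e * norm x" by blast
qed

lemma tail_small_sum:
  assumes "finite A" "\<And>i. i \<in> A \<Longrightarrow> tail_small (T i)"
  shows "tail_small (\<lambda>x. \<Sum>i\<in>A. T i x)"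
  using assms
proof (induction A rule: finite_induct)
  case empty
  then show ?case by (auto simp: tail_small_def)
next
  case (insert i A)
  then have "tail_small (\<lambda>x. T i x + (\<Sum>i\<in>A. T i x))" by (intro tail_small_add) auto
  then show ?case using insert by simp
qed

lemma tail_small_bounded_linear_comp:
  assumes "tail_small T" "bounded_linear f"
  shows "tail_small (\<lambda>x. f (T x))"
  unfolding tail_small_def
proof (intro allI impI)
  fix e :: real assume "e > 0"
  obtain K where K: "K > 0" "\<And>x. norm (f x) \<le> norm x * K"
    using bounded_linear.pos_bounded[OF assms(2)] by blast
  then have "e / K > 0" using \<open>e > 0\<close> by simp
  then obtain N where N: "\<And>x. restrict_l2 {..<N} x = 0 \<Longrightarrow> norm (T x) \<le> e / K * norm x"
    using assms(1) unfolding tail_small_def by blast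
  have "norm (f (T x)) \<le> e * norm x" if "restrict_l2 {..<N} x = 0" for x
  proof -
    have "norm (f (T x)) \<le> norm (T x) * K" by (rule K)
    also have "\<dots> \<le> (e / K * norm x) * K" using N[OF that] K(1) by (intro mult_right_mono) auto
    also have "\<dots> = e * norm x" using K(1) by simp
    finally show ?thesis .
  qed
  then show "\<exists>N. \<forall>x. restrict_l2 {..<N} x = 0 \<longrightarrow> norm (f (T x)) \<le> e * norm x" by blast
qed

lemma tail_small_uminus: "tail_small (\<lambda>x. - T x) \<longleftrightarrow> tail_small T"
  by (simp add: tail_small_def)

text \<open>On the kernel of \<open>\<phi>\<close> the operator \<open>x \<mapsto> x - J (P x)\<close> intertwines \<open>P\<close> and \<open>J\<close>. Corrected by a rank
  one term so that it annihilates \<open>x0\<close>, it is a compact perturbation of twice the identity, hence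
  of index zero. Its cokernel is even-dimensional because of \<open>J\<close>, its kernel odd-dimensional because of \<open>P\<close>
  and the extra direction \<open>x0\<close>.\<close>

lemma complex_structure_hyperplane_not_tail_small:
  fixes J P :: "l2 \<Rightarrow> l2" and \<phi> :: "l2 \<Rightarrow> real"
  assumes J: "bounded_linear J" "\<And>x. J (J x) = - x"
    and P: "bounded_linear P" "P x0 = 0" "\<And>x. P (P x) = \<phi> x *\<^sub>R x0 - x"
    and \<phi>: "bounded_linear \<phi>" "\<phi> x0 = 1"
  shows "\<not> tail_small (\<lambda>x. J x - P x)"
proof
  assume ts: "tail_small (\<lambda>x. J x - P x)"
  interpret J: bounded_linear J by fact
  interpret P: bounded_linear P by fact
  interpret \<phi>: bounded_linear \<phi> by fact
  have "x0 \<noteq> 0" using \<phi> \<phi>.zero by force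
  \<comment> \<open>Two expressions for \<open>P (P (P x))\<close> are compared; the result is that
    \<open>P\<close> maps into the kernel of \<open>\<phi>\<close>.\<close>
  have \<phi>P: "\<phi> (P x) = 0" for x
  proof -
    have "\<phi> (P x) *\<^sub>R x0 - P x = P (\<phi> x *\<^sub>R x0 - x)" using P(3) by metis
    also have "\<dots> = - P x" by (simp add: P.diff P.scaleR P(2))
    finally show ?thesis using \<open>x0 \<noteq> 0\<close> by simp
  qed
  \<comment> \<open>Chosen so that \<open>2 *\<^sub>R x + D x\<close> equals
    \<open>x - J (P x) - \<phi> x *\<^sub>R x0\<close>, the intertwiner corrected to annihilate
    \<open>x0\<close>.\<close>
  define D where "D x = J (J x - P x) + - (\<phi> x *\<^sub>R x0)" for x
  have D: "bounded_linear D"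
    unfolding D_def
    by (intro bounded_linear_add bounded_linear_minus bounded_linear_sub
        bounded_linear_compose[OF J(1)] bounded_linear_scaleR_const J(1) P(1) \<phi>(1))
  interpret D: bounded_linear D by fact
  have "tail_small D"
    unfolding D_def
    by (intro tail_small_add tail_small_bounded_linear_comp[OF ts J(1)])
      (simp add: tail_small_uminus tail_small_scaleR_functional \<phi>)
  then have "\<exists>N. \<forall>x. restrict_l2 {..<N} x = 0 \<longrightarrow> norm (D x) \<le> 1 * norm x"
    unfolding tail_small_def using zero_less_one by blast
  then obtain N where N: "\<And>x. restrict_l2 {..<N} x = 0 \<Longrightarrow> norm (D x) \<le> norm x"
    by auto
  let ?r = "restrict_l2 {..<N}"
  interpret r: bounded_linear ?r by (rule bounded_linear_restrict_l2)
  \<comment> \<open>On tails \<open>D\<close> has norm at most one, and after truncation to the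
    first \<open>N\<close> coordinates it has finite rank; the index argument needs exactly this
    splitting.\<close>
  define A where "A x = 2 *\<^sub>R x + D (x - ?r x) + D (?r x)" for x
  have A: "A x = x - J (P x) - \<phi> x *\<^sub>R x0" for x
  proof -
    have "A x = 2 *\<^sub>R x + D x" by (simp add: A_def D.diff)
    then show ?thesis by (simp add: D_def J J.diff scaleR_2)
  qed
  \<comment> \<open>The rank-one correction preserves the intertwining: \<open>\<phi>\<close>
    vanishes on the range of \<open>P\<close>, and the \<open>x0\<close>-term of
    \<open>P (P x)\<close> matches \<open>J\<close> of the correction. Hence the range of
    \<open>A\<close> is \<open>J\<close>-invariant and its kernel
    \<open>P\<close>-invariant.\<close>
  have AP: "A (P x) = J (A x)" for x
    by (simp add: A P J \<phi>P J.diff J.scaleR)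
  have linA: "linear A"
    by (rule linearI)
      (simp_all add: A J.add P.add \<phi>.add J.scaleR P.scaleR \<phi>.scaleR scaleR_add_left
        scaleR_diff_right)
  have S: "bounded_linear (\<lambda>x. D (x - ?r x))"
    by (intro bounded_linear_compose[OF D] bounded_linear_sub bounded_linear_ident
        bounded_linear_restrict_l2)
  have Sle: "norm (D (x - ?r x)) \<le> norm x" for x
  proof -
    have "norm (D (x - ?r x)) \<le> norm (x - ?r x)"
      by (rule N) (auto intro!: l2_eqI simp: coord_restrict_l2)
    also have "\<dots> \<le> norm x" by (rule norm_le_coord) (simp add: coord_restrict_l2)
    finally show ?thesis .
  qed
  have linF: "linear (\<lambda>x. D (?r x))"
    by (rule linearI) (simp_all add: r.add D.add r.scaleR D.scaleR)
  have rangeF: "range (\<lambda>x. D (?r x)) \<subseteq> span ((\<lambda>i. D (unit_l2 i)) ` {..<N})"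
    by (auto simp: restrict_l2_eq_sum D.sum D.scaleR intro!: span_sum span_scale intro: span_base)
  have JA: "J ` range A \<subseteq> range A" by (auto simp flip: AP)
  have finC: "finite ((\<lambda>i. D (unit_l2 i)) ` {..<N})" by simp
  have even: "even (dim {x. A x = 0})" "\<exists>C. finite C \<and> {x. A x = 0} \<subseteq> span C"
    by (rule even_dim_kernel_of_invariant_range[of "\<lambda>x. D (x - ?r x)" "\<lambda>x. D (?r x)" _ J A];
      fact S Sle linF rangeF finC J.linear J(2) A_def JA)+
  let ?Ker = "{x. A x = 0}"
  let ?M = "{x\<in>?Ker. \<phi> x = 0}"
  obtain C where C: "finite C" "?Ker \<subseteq> span C" using even by auto
  have subK: "subspace ?Ker" using linA by (rule linear_subspace_kernel)
  \<comment> \<open>Since \<open>x0\<close> lies in the kernel, the kernel exceeds \<open>?M\<close>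
    by one dimension. On \<open>?M\<close> the operator \<open>P\<close> squares to
    \<open>-1\<close>, so \<open>dim ?M\<close> is even and the kernel is odd-dimensional.\<close>
  have "dim ?Ker = dim ?M + dim (\<phi> ` ?Ker)"
    using rank_nullity_subspace[OF \<phi>.linear subK C(2,1)] .
  moreover have "\<phi> ` ?Ker = UNIV"
  proof -
    have "A x0 = 0" by (simp add: A P(2) \<phi>(2) J.zero)
    then have "t *\<^sub>R x0 \<in> ?Ker" "\<phi> (t *\<^sub>R x0) = t" for t
      using linA by (auto simp: linear_cmul \<phi>.scaleR \<phi>(2))
    then show ?thesis by (metis UNIV_eq_I imageI)
  qed
  moreover have "even (dim ({0} :: l2 set) + dim ?M)"
  proof (rule even_dim_add_invariant_subspace[OF P.linear _ _ C(1)])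
    have eq: "?M = ?Ker \<inter> {x. \<phi> x = 0}" by blast
    show "subspace ?M"
      unfolding eq by (rule subspace_inter[OF subK linear_subspace_kernel[OF \<phi>.linear]])
    show "?M \<subseteq> span C" using C by blast
    show "P ` ?M \<subseteq> ?M" using AP \<phi>P J.zero by auto
    show "\<And>x. x \<in> ?M \<Longrightarrow> P (P x) = - x" by (simp add: P)
    show "{0} \<subseteq> ?M" using linA \<phi>.zero by (simp add: linear_0)
  qed (auto simp: P.zero subspace_single_0)
  ultimately show False using even(1) by (simp add: dim_zero_subspace)
qed

section \<open>Quasi-linearity of the Kalton--Peck map\<close>

lemma kalton_peck_zero: "kalton_peck 0 = 0"
  by (auto simp: kalton_peck_def)

lemma ell2_norm_scaleR: "x \<in> ell2 \<Longrightarrow> ell2_norm (c *\<^sub>R x) = \<bar>c\<bar> * ell2_norm x"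
proof -
  assume "x \<in> ell2"
  then have "ell2_norm (coord (c *\<^sub>R Abs_l2 x)) = \<bar>c\<bar> * ell2_norm (coord (Abs_l2 x))"
    unfolding ell2_norm_coord by simp
  then show ?thesis using \<open>x \<in> ell2\<close> by (simp add: Abs_l2_inverse)
qed

lemma kalton_peck_scaleR:
  assumes "x \<in> ell2"
  shows "kalton_peck (c *\<^sub>R x) = c *\<^sub>R kalton_peck x"
  using ell2_norm_scaleR[OF assms, of c]
  by (cases "c = 0") (auto simp: kalton_peck_def scaleR_fun_def abs_mult)

section \<open>Bounds for \<open>t * ln t\<close> and its failure of additivity\<close>

lemma abs_mult_ln_le:
  fixes t :: real
  assumes "t \<ge> 0"
  shows "\<bar>t * ln t\<bar> \<le> 1 + t\<^sup>2"
proof (cases "t = 0")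
  case False
  then have t: "t > 0" using assms by simp
  have "t * ln t \<le> t * (t - 1)" using t ln_le_minus_one[OF t] by (intro mult_left_mono) auto
  moreover have "- ln t \<le> inverse t - 1" using ln_le_minus_one[of "inverse t"] t by (simp add: ln_inverse)
  then have "t * (- ln t) \<le> t * (inverse t - 1)" using t by (intro mult_left_mono) auto
  then have "- (t * ln t) \<le> 1 - t" using t by (simp add: algebra_simps)
  moreover have "t * (t - 1) \<le> 1 + t\<^sup>2" using t by (simp add: power2_eq_square algebra_simps)
  moreover have "0 \<le> t\<^sup>2" by simp
  ultimately show ?thesis using t by linarith
qed simp

lemma abs_mult_ln_le_1:
  fixes t :: real
  assumes "0 \<le> t" "t \<le> 1"
  shows "\<bar>t * ln t\<bar> \<le> 1"
proof (cases "t = 0")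
  case False
  then have t: "t > 0" using assms by simp
  have "- ln t \<le> inverse t - 1" using ln_le_minus_one[of "inverse t"] t by (simp add: ln_inverse)
  then have "t * (- ln t) \<le> t * (inverse t - 1)" using t by (intro mult_left_mono) auto
  then have "- (t * ln t) \<le> 1" using t by (simp add: algebra_simps)
  moreover have "t * ln t \<le> 0" using assms t by (simp add: mult_nonneg_nonpos)
  ultimately show ?thesis by linarith
qed simp

text \<open>The scalar function behind \<open>kalton_peck\<close> before normalisation; the factor
  \<open>t\<close> gives the value \<open>0\<close> at \<open>0\<close>, in agreement with the
  convention there.\<close>

definition abs_ln :: "real \<Rightarrow> real" where
  "abs_ln t = t * ln \<bar>t\<bar>"

lemma abs_ln_uminus: "abs_ln (- t) = - abs_ln t"
  by (simp add: abs_ln_def)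

text \<open>The difference splits into \<open>s * (ln (s + t) - ln s)\<close> and its mirror image;
  since \<open>ln (1 + r) \<le> r\<close> for \<open>r \<ge> 0\<close>, each is nonnegative and
  bounded by the other variable.\<close>

lemma abs_ln_add_nonneg:
  assumes "0 \<le> s" "0 \<le> t"
  shows "\<bar>abs_ln (s + t) - abs_ln s - abs_ln t\<bar> \<le> s + t"
proof (cases "s = 0 \<or> t = 0")
  case True
  then show ?thesis using assms by (auto simp: abs_ln_def)
next
  case False
  then have p: "s > 0" "t > 0" using assms by auto
  have *: "0 \<le> a * (ln (a + b) - ln a)" "a * (ln (a + b) - ln a) \<le> b" if "a > 0" "b > 0" for a b :: real
  proof -
    show "0 \<le> a * (ln (a + b) - ln a)" using that by simp
    have "1 + b / a = (a + b) / a" using that by (simp add: field_simps)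
    then have "ln (a + b) - ln a = ln (1 + b / a)" using that by (simp add: ln_div)
    also have "\<dots> \<le> b / a" using that by (intro ln_add_one_self_le_self) auto
    finally have "a * (ln (a + b) - ln a) \<le> a * (b / a)" using that by (intro mult_left_mono) auto
    then show "a * (ln (a + b) - ln a) \<le> b" using that by simp
  qed
  have "abs_ln (s + t) - abs_ln s - abs_ln t = s * (ln (s + t) - ln s) + t * (ln (t + s) - ln t)"
    using p by (simp add: abs_ln_def algebra_simps)
  with *[OF p] *[OF p(2,1)] show ?thesis by linarith
qed

text \<open>Equal signs follow from the nonnegative case and oddness. Opposite signs are reduced to
  it by reading the larger absolute value as the sum of the smaller one and the difference.\<close>

lemma abs_ln_add: "\<bar>abs_ln (s + t) - abs_ln s - abs_ln t\<bar> \<le> \<bar>s\<bar> + \<bar>t\<bar>"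
proof -
  have opp: "\<bar>abs_ln (s - r) - abs_ln s + abs_ln r\<bar> \<le> s + r" if "0 \<le> s" "0 \<le> r" for s r
  proof (cases "r \<le> s")
    case True
    then show ?thesis using abs_ln_add_nonneg[of "s - r" r] that by (auto simp: abs_if split: if_splits)
  next
    case False
    then show ?thesis using abs_ln_add_nonneg[of "r - s" s] that abs_ln_uminus[of "r - s"]
      by (auto simp: abs_if split: if_splits)
  qed
  consider "0 \<le> s" "0 \<le> t" | "0 \<le> s" "t \<le> 0" | "s \<le> 0" "0 \<le> t" | "s \<le> 0" "t \<le> 0" by linarith
  then show ?thesis
  proof cases
    case 1
    then show ?thesis using abs_ln_add_nonneg[of s t] by simp
  next
    case 2
    then show ?thesis using opp[of s "- t"] abs_ln_uminus[of t] by simp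
  next
    case 3
    then show ?thesis using opp[of t "- s"] abs_ln_uminus[of s] by (simp add: algebra_simps)
  next
    case 4
    have "abs_ln (- s + - t) = - abs_ln (s + t)" using abs_ln_uminus[of "s + t"] by simp
    then show ?thesis using 4 abs_ln_add_nonneg[of "- s" "- t"] abs_ln_uminus[of s] abs_ln_uminus[of t]
      by simp
  qed
qed

text \<open>Rescaling by \<open>m\<close> separates the pointwise part of the Kalton--Peck map from its
  dependence on the norm.\<close>

lemma kalton_peck_rescale:
  assumes "m > 0"
  shows "kalton_peck (coord x) i
    = m * abs_ln (coord x i / m) - ln (norm x / m) * coord x i"
proof (cases "coord x i = 0")
  case True
  then show ?thesis by (simp add: kalton_peck_def abs_ln_def)
next
  case False
  then have "norm x > 0" by auto
  then show ?thesis using False assms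
    by (simp add: kalton_peck_def abs_ln_def ell2_norm_coord ln_div algebra_simps)
qed

lift_definition abs_l2 :: "l2 \<Rightarrow> l2" is "\<lambda>x i. \<bar>x i\<bar>"
  by (erule ell2_dominated) auto

lemma norm_abs_l2: "norm (abs_l2 x) = norm x"
  by (intro antisym norm_le_coord) (auto simp: abs_l2.rep_eq)

text \<open>Rescaling all three terms by the same \<open>m\<close> leaves a pointwise part,
  dominated coordinatewise by \<open>abs_l2 x + abs_l2 y\<close>, and three multiples
  \<open>ln (norm v / m) *\<^sub>R v\<close>. Each of the four pieces has norm at most
  \<open>m\<close>, the latter because \<open>t * ln t\<close> is bounded by one on the unit
  interval.\<close>

lemma kalton_peck_quasilinear:
  defines "d \<equiv> \<lambda>x y. kalton_peck (coord (x + y)) - kalton_peck (coord x) - kalton_peck (coord y)"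
  shows "d x y \<in> ell2" "ell2_norm (d x y) \<le> 4 * (norm x + norm y)"
proof -
  define m where "m = norm x + norm y"
  have "\<exists>z. d x y = coord z \<and> norm z \<le> 4 * m"
  proof (cases "m = 0")
    case True
    then have "norm x = 0" "norm y = 0" unfolding m_def by (simp_all add: add_nonneg_eq_0_iff)
    then show ?thesis unfolding d_def
      by (intro exI[of _ 0]) (simp add: kalton_peck_zero m_def)
  next
    case False
    then have m: "m > 0" unfolding m_def by (simp add: less_le)
    define u where "u i = m * (abs_ln (coord x i / m + coord y i / m)
        - abs_ln (coord x i / m) - abs_ln (coord y i / m))" for i
    define w where "w = abs_l2 x + abs_l2 y"
    have uw: "\<bar>u i\<bar> \<le> \<bar>coord w i\<bar>" for i
    proof -
      have "\<bar>u i\<bar> \<le> m * (\<bar>coord x i / m\<bar> + \<bar>coord y i / m\<bar>)"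
        unfolding u_def abs_mult using m by (intro mult_mono abs_ln_add) auto
      also have "\<dots> = \<bar>coord x i\<bar> + \<bar>coord y i\<bar>" using m by (simp add: distrib_left)
      finally show ?thesis by (simp add: w_def abs_l2.rep_eq)
    qed
    then have cu: "coord (Abs_l2 u) = u"
      using ell2_dominated[OF coord_ell2 uw] by (simp add: Abs_l2_inverse)
    have nu: "norm (Abs_l2 u) \<le> m"
    proof -
      have "norm (Abs_l2 u) \<le> norm w" by (rule norm_le_coord) (simp add: cu uw)
      also have "\<dots> \<le> m" unfolding w_def m_def using norm_triangle_ineq[of "abs_l2 x" "abs_l2 y"]
        by (simp add: norm_abs_l2)
      finally show ?thesis .
    qed
    define z where "z = Abs_l2 u - ln (norm (x + y) / m) *\<^sub>R (x + y)
        + ln (norm x / m) *\<^sub>R x + ln (norm y / m) *\<^sub>R y"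
    have "d x y = coord z"
    proof
      fix i
      have "d x y i = kalton_peck (coord (x + y)) i - kalton_peck (coord x) i - kalton_peck (coord y) i"
        by (simp add: d_def)
      also have "\<dots> = coord z i"
        unfolding kalton_peck_rescale[OF m]
        by (simp add: z_def cu u_def scaleR_fun_def add_divide_distrib algebra_simps)
      finally show "d x y i = coord z i" .
    qed
    moreover have "norm (ln (norm v / m) *\<^sub>R v) \<le> m" if "norm v \<le> m" for v :: l2
    proof -
      have "\<bar>norm v / m * ln (norm v / m)\<bar> \<le> 1"
        using that m by (intro abs_mult_ln_le_1) auto
      then have "m * \<bar>norm v / m * ln (norm v / m)\<bar> \<le> m * 1" using m by (intro mult_left_mono) auto
      then show ?thesis using m by (simp add: abs_mult mult.commute)
    qed
    from this[of "x + y"] this[of x] this[of y] nu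
    have "norm z \<le> m + m + m + m"
      unfolding z_def m_def[symmetric]
      by (intro norm_triangle_le norm_triangle_le_diff add_mono)
        (auto simp: m_def norm_triangle_ineq)
    ultimately show ?thesis by auto
  qed
  then obtain z where "d x y = coord z" "norm z \<le> 4 * m" by blast
  then show "d x y \<in> ell2" "ell2_norm (d x y) \<le> 4 * (norm x + norm y)"
    by (simp_all add: ell2_norm_coord m_def)
qed

section \<open>Additivity defects of the Kalton-Peck map\<close>

text \<open>An element of \<open>l2\<close>, although the individual Kalton-Peck images need not be
  square-summable.\<close>

definition kp_defect :: "l2 \<Rightarrow> l2 \<Rightarrow> l2" where
  "kp_defect x y =
     Abs_l2 (kalton_peck (coord (x + y)) - kalton_peck (coord x) - kalton_peck (coord y))"

lemma coord_kp_defect: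
  "coord (kp_defect x y) =
     kalton_peck (coord (x + y)) - kalton_peck (coord x) - kalton_peck (coord y)"
  unfolding kp_defect_def by (rule Abs_l2_inverse[OF kalton_peck_quasilinear(1)])

lemma norm_kp_defect_le: "norm (kp_defect x y) \<le> 4 * (norm x + norm y)"
  using kalton_peck_quasilinear(2)[of x y] by (simp only: ell2_norm_coord flip: coord_kp_defect)

lemma kp_defect_scaleR: "kp_defect (c *\<^sub>R x) (c *\<^sub>R y) = c *\<^sub>R kp_defect x y"
proof -
  have "coord (kp_defect (c *\<^sub>R x) (c *\<^sub>R y)) = coord (c *\<^sub>R kp_defect x y)"
    unfolding coord_kp_defect scaleR_right_distrib[symmetric] coord_simps(5)
    by (simp only: kalton_peck_scaleR[OF coord_ell2] scaleR_right_diff_distrib)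
  then show ?thesis by (simp only: coord_inject)
qed

lemma kp_defect_zero_left: "kp_defect 0 x = 0"
proof -
  have "coord (kp_defect 0 x) = coord 0"
    unfolding coord_kp_defect by (simp add: kalton_peck_zero)
  then show ?thesis by (simp only: coord_inject)
qed

text \<open>The recursion keeps the defect of a finite sum inside \<open>l2\<close> by construction;
  the closed form is \<open>coord_kp_sum_defect\<close>.\<close>

primrec kp_sum_defect :: "(nat \<Rightarrow> l2) \<Rightarrow> nat \<Rightarrow> l2" where
  "kp_sum_defect z 0 = 0"
| "kp_sum_defect z (Suc n) = kp_sum_defect z n + kp_defect (\<Sum>i<n. z i) (z n)"

lemma coord_kp_sum_defect:
  "coord (kp_sum_defect z n) =
     kalton_peck (coord (\<Sum>i<n. z i)) - (\<Sum>i<n. kalton_peck (coord (z i)))"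
proof (induction n)
  case 0
  show ?case
    unfolding kp_sum_defect.simps lessThan_0 sum.empty coord_simps(1) kalton_peck_zero by simp
next
  case (Suc n)
  show ?case unfolding kp_sum_defect.simps coord_simps(2)[of "kp_sum_defect z n"] Suc coord_kp_defect
    by (simp del: coord_simps plus_fun_apply minus_apply add: algebra_simps)
qed

text \<open>A cocycle identity: expanded into Kalton-Peck images, both sides agree. It serves to
  separate small errors \<open>d\<close> from disjoint blocks \<open>y\<close>.\<close>

lemma kp_sum_defect_add:
  "kp_sum_defect (\<lambda>i. y i + d i) n = kp_sum_defect y n + kp_sum_defect d n
     + kp_defect (\<Sum>i<n. y i) (\<Sum>i<n. d i) - (\<Sum>i<n. kp_defect (y i) (d i))"
proof -
  have "coord (kp_sum_defect (\<lambda>i. y i + d i) n) = coord (kp_sum_defect y n + kp_sum_defect d n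
     + kp_defect (\<Sum>i<n. y i) (\<Sum>i<n. d i) - (\<Sum>i<n. kp_defect (y i) (d i)))"
    unfolding coord_simps(2)[of "_ + _ :: l2"] coord_simps(3) coord_simps(2)[of "kp_sum_defect y n"]
      coord_sum[of "\<lambda>i. kp_defect (y i) (d i)"] coord_kp_defect coord_kp_sum_defect
    by (simp del: coord_simps add: sum.distrib sum_subtractf)
  then show ?thesis by (simp only: coord_inject)
qed

text \<open>Crude, but applied to errors of norm at most \<open>1 / (real n)\<^sup>2\<close>, for
  which the bound is constant.\<close>

lemma norm_kp_sum_defect_le:
  assumes "\<And>i. i < n \<Longrightarrow> norm (z i) \<le> e"
  shows "norm (kp_sum_defect z n) \<le> 4 * (real n)\<^sup>2 * e"
  using assms
proof (induction n)
  case (Suc n)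
  have e: "e \<ge> 0" using Suc.prems[of n] norm_ge_zero[of "z n"] by linarith
  have "norm (\<Sum>i<n. z i) \<le> real n * e"
    using sum_norm_bound[of "{..<n}" z e] Suc.prems by simp
  then have "norm (kp_defect (\<Sum>i<n. z i) (z n)) \<le> 4 * (real n * e + e)"
    using norm_kp_defect_le[of "\<Sum>i<n. z i" "z n"] Suc.prems[of n] by simp
  moreover have "norm (kp_sum_defect z n) \<le> 4 * (real n)\<^sup>2 * e" using Suc by simp
  ultimately have "norm (kp_sum_defect z (Suc n)) \<le> 4 * (real n)\<^sup>2 * e + 4 * (real n * e + e)"
    using norm_triangle_ineq[of "kp_sum_defect z n" "kp_defect (\<Sum>i<n. z i) (z n)"] by simp
  also have "\<dots> \<le> 4 * (real (Suc n))\<^sup>2 * e"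
    using e by (simp add: power2_eq_square algebra_simps)
  finally show ?case .
qed simp

text \<open>At each coordinate at most one summand is nonzero, so the logarithms of the entries
  cancel and only those of the norms remain. For \<open>n\<close> unit vectors this leaves
  \<open>- ln (sqrt n)\<close> times their sum, the source of the logarithmic growth.\<close>

lemma kp_sum_defect_disjoint:
  assumes "\<And>i j k. i < n \<Longrightarrow> j < n \<Longrightarrow> i \<noteq> j \<Longrightarrow> coord (z i) k = 0 \<or> coord (z j) k = 0"
  shows "kp_sum_defect z n =
    (\<Sum>i<n. ln (norm (z i)) *\<^sub>R z i) - ln (norm (\<Sum>i<n. z i)) *\<^sub>R (\<Sum>i<n. z i)"
proof (rule l2_eqI)
  fix k
  let ?s = "\<Sum>i<n. z i"
  have lhs: "coord (kp_sum_defect z n) k = kalton_peck (coord ?s) k - (\<Sum>i<n. kalton_peck (coord (z i)) k)"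
    unfolding coord_kp_sum_defect by (simp del: coord_simps) (induction n, auto)
  have rhs: "coord ((\<Sum>i<n. ln (norm (z i)) *\<^sub>R z i) - ln (norm ?s) *\<^sub>R ?s) k
    = (\<Sum>i<n. ln (norm (z i)) * coord (z i) k) - ln (norm ?s) * coord ?s k"
    by (simp add: coord_sum_at scaleR_fun_def)
  show "coord (kp_sum_defect z n) k =
    coord ((\<Sum>i<n. ln (norm (z i)) *\<^sub>R z i) - ln (norm ?s) *\<^sub>R ?s) k"
  proof (cases "\<exists>i<n. coord (z i) k \<noteq> 0")
    case False
    then have "coord ?s k = 0" by (simp add: coord_sum_at)
    then show ?thesis unfolding lhs rhs using False by (simp add: kalton_peck_def)
  next
    case True
    then obtain j where j: "j < n" "coord (z j) k \<noteq> 0" by blast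
    have other: "coord (z i) k = 0" if "i < n" "i \<noteq> j" for i using assms[OF that(1) j(1) that(2)] j(2) by auto
    have single: "(\<Sum>i<n. f i) = f j" if "\<And>i. i < n \<Longrightarrow> i \<noteq> j \<Longrightarrow> f i = 0" for f :: "nat \<Rightarrow> real"
      using j(1) that by (subst sum.mono_neutral_right[of "{..<n}" "{j}"]) auto
    have s: "coord ?s k = coord (z j) k" unfolding coord_sum_at using other by (rule single)
    then have "norm ?s > 0" "norm (z j) > 0" using j(2) by auto
    moreover have "(\<Sum>i<n. kalton_peck (coord (z i)) k) = kalton_peck (coord (z j)) k"
      using other by (intro single) (simp add: kalton_peck_def)
    moreover have "(\<Sum>i<n. ln (norm (z i)) * coord (z i) k) = ln (norm (z j)) * coord (z j) k"
      using other by (intro single) simp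
    ultimately show ?thesis unfolding lhs rhs s using j(2)
      by (simp add: kalton_peck_def s ell2_norm_coord ln_div algebra_simps)
  qed
qed

section \<open>The diagonal of an upper triangular operator on Z2\<close>

text \<open>Chosen greedily: averaging over the sign of the last term, the parallelogram law adds
  exactly the last summand of the left-hand side.\<close>

lemma signs_parallelogram:
  fixes a b :: "nat \<Rightarrow> 'a::real_inner"
  shows "\<exists>s :: nat \<Rightarrow> real. (\<forall>i. \<bar>s i\<bar> = 1) \<and>
    (\<Sum>i<n. (norm (a i))\<^sup>2 - c * (norm (b i))\<^sup>2)
      \<le> (norm (\<Sum>i<n. s i *\<^sub>R a i))\<^sup>2 - c * (norm (\<Sum>i<n. s i *\<^sub>R b i))\<^sup>2"
proof (induction n)
  case 0
  show ?case by (intro exI[of _ "\<lambda>_. 1"]) simp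
next
  case (Suc n)
  then obtain s :: "nat \<Rightarrow> real" where s: "\<forall>i. \<bar>s i\<bar> = 1"
    and le: "(\<Sum>i<n. (norm (a i))\<^sup>2 - c * (norm (b i))\<^sup>2)
      \<le> (norm (\<Sum>i<n. s i *\<^sub>R a i))\<^sup>2 - c * (norm (\<Sum>i<n. s i *\<^sub>R b i))\<^sup>2"
    by blast
  define A where "A = (\<Sum>i<n. s i *\<^sub>R a i)"
  define B where "B = (\<Sum>i<n. s i *\<^sub>R b i)"
  define f where "f t = (norm (A + t *\<^sub>R a n))\<^sup>2 - c * (norm (B + t *\<^sub>R b n))\<^sup>2" for t :: real
  have "f 1 + f (- 1) = 2 * ((norm A)\<^sup>2 - c * (norm B)\<^sup>2 + ((norm (a n))\<^sup>2 - c * (norm (b n))\<^sup>2))"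
    unfolding f_def power2_norm_eq_inner
    by (simp add: inner_add_left inner_add_right inner_diff_left inner_diff_right inner_commute algebra_simps)
  then obtain t :: real where t: "\<bar>t\<bar> = 1"
    "(norm A)\<^sup>2 - c * (norm B)\<^sup>2 + ((norm (a n))\<^sup>2 - c * (norm (b n))\<^sup>2) \<le> f t"
    by (metis abs_1 abs_minus_cancel linorder_le_cases mult_2 add_mono_thms_linordered_field(5)
        linorder_not_le)
  let ?s = "s(n := t)"
  have "(\<Sum>i<Suc n. ?s i *\<^sub>R v i) = (\<Sum>i<n. s i *\<^sub>R v i) + t *\<^sub>R v n" for v :: "nat \<Rightarrow> 'a"
    by simp
  then have "(\<Sum>i<Suc n. (norm (a i))\<^sup>2 - c * (norm (b i))\<^sup>2)
      \<le> (norm (\<Sum>i<Suc n. ?s i *\<^sub>R a i))\<^sup>2 - c * (norm (\<Sum>i<Suc n. ?s i *\<^sub>R b i))\<^sup>2"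
    using le t(2) unfolding f_def A_def B_def by simp
  then show ?case using s t(1) by (intro exI[of _ ?s]) auto
qed

lemma norm_sum_orthonormal_signs:
  fixes x :: "nat \<Rightarrow> 'a::real_inner"
  assumes "\<And>i. i < n \<Longrightarrow> norm (x i) = 1" "\<And>i j. i < n \<Longrightarrow> j < n \<Longrightarrow> i \<noteq> j \<Longrightarrow> inner (x i) (x j) = 0"
    and "\<And>i. \<bar>s i\<bar> = 1"
  shows "norm (\<Sum>i<n. s i *\<^sub>R x i) = sqrt (real n)"
proof -
  have "(norm (\<Sum>i<n. s i *\<^sub>R x i))\<^sup>2 = (\<Sum>i<n. (norm (s i *\<^sub>R x i))\<^sup>2)"
    by (rule norm_sum_Pythagorean)
      (use assms(2) in \<open>auto simp: pairwise_def orthogonal_def\<close>)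
  also have "\<dots> = real n" using assms by simp
  finally show ?thesis by (metis norm_ge_zero real_sqrt_unique)
qed

lemma inner_l2_disjoint:
  assumes "\<And>k. coord x k = 0 \<or> coord y k = 0"
  shows "inner x y = 0"
proof -
  have "coord x k * coord y k = 0" for k using assms[of k] by auto
  then show ?thesis unfolding inner_l2.rep_eq by (simp only: suminf_zero)
qed

text \<open>The coordinates of a bounded operator \<open>(b + \<K>x, x) \<mapsto> (\<alpha> b + g x + \<K>(\<beta> x), \<beta> x)\<close> on \<open>Z2\<close>;
  the identity \<open>twist\<close> expresses its additivity.\<close>

locale Z2_operator =
  fixes \<alpha> \<beta> g :: "l2 \<Rightarrow> l2" and C :: real
  assumes \<alpha>: "bounded_linear \<alpha>" and \<beta>: "bounded_linear \<beta>"
    and g_le: "norm (g x) \<le> C * norm x"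
    and g_scaleR: "g (c *\<^sub>R x) = c *\<^sub>R g x"
    and twist: "\<alpha> (kp_defect x y) - kp_defect (\<beta> x) (\<beta> y) = g (x + y) - g x - g y"
begin

sublocale \<alpha>: bounded_linear \<alpha> by (rule \<alpha>)
sublocale \<beta>: bounded_linear \<beta> by (rule \<beta>)

text \<open>\<open>twist\<close> telescopes along the recursion of
  \<open>kp_sum_defect\<close>.\<close>

lemma twist_sum:
  "\<alpha> (kp_sum_defect z n) - kp_sum_defect (\<lambda>i. \<beta> (z i)) n = g (\<Sum>i<n. z i) - (\<Sum>i<n. g (z i))"
proof (induction n)
  case 0
  show ?case using g_scaleR[of 0 0] by (simp add: \<alpha>.zero)
next
  case (Suc n)
  have "\<alpha> (kp_sum_defect z (Suc n)) - kp_sum_defect (\<lambda>i. \<beta> (z i)) (Suc n)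
    = (\<alpha> (kp_sum_defect z n) - kp_sum_defect (\<lambda>i. \<beta> (z i)) n)
      + (\<alpha> (kp_defect (\<Sum>i<n. z i) (z n)) - kp_defect (\<beta> (\<Sum>i<n. z i)) (\<beta> (z n)))"
    by (simp add: \<alpha>.add \<beta>.sum)
  also have "\<dots> = g (\<Sum>i<Suc n. z i) - (\<Sum>i<Suc n. g (z i))"
    unfolding Suc twist by simp
  finally show ?case .
qed

text \<open>The right-hand side is independent of \<open>n\<close>, while the left grows with it.
  For a signed sum \<open>X\<close> of the blocks, \<open>twist_sum\<close> expresses
  \<open>L *\<^sub>R (\<alpha> X - \<beta> X)\<close>, with \<open>L = ln (sqrt n)\<close>, as a
  term \<open>E\<close> of order \<open>sqrt n\<close> plus a signed sum of bounded vectors;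
  suitable signs let the latter be absorbed.\<close>

lemma block_bound:
  fixes x y :: "nat \<Rightarrow> l2"
  assumes n: "n > 0" and b: "b \<ge> 0" "\<And>v. norm (\<beta> v) \<le> b * norm v"
    and e: "e \<ge> 0"
    and x: "\<And>i. i < n \<Longrightarrow> norm (x i) = 1"
    and x_disjoint: "\<And>i j k. i < n \<Longrightarrow> j < n \<Longrightarrow> i \<noteq> j \<Longrightarrow> coord (x i) k = 0 \<or> coord (x j) k = 0"
    and y_disjoint: "\<And>i j k. i < n \<Longrightarrow> j < n \<Longrightarrow> i \<noteq> j \<Longrightarrow> coord (y i) k = 0 \<or> coord (y j) k = 0"
    and y: "\<And>i. i < n \<Longrightarrow> norm (y i) \<le> b"
    and near: "\<And>i. i < n \<Longrightarrow> norm (\<beta> (x i) - y i) \<le> 1 / (real n)\<^sup>2"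
    and large: "\<And>i. i < n \<Longrightarrow> e \<le> norm (\<alpha> (x i) - \<beta> (x i))"
  shows "(ln (sqrt (real n)) * e)\<^sup>2
    \<le> 2 * (((1 + (b + 1)\<^sup>2) + 4 + 4 * (b + 2) + C + 1)\<^sup>2 + (1 + b\<^sup>2 + 4 * (b + 1) + C)\<^sup>2)"
proof -
  let ?n = "real n"
  define w where "w = sqrt ?n"
  have w1: "w \<ge> 1" using n by (simp add: w_def)
  define L where "L = ln w"
  have L0: "L \<ge> 0" using w1 by (simp add: L_def)
  have Lw: "L \<le> w" using w1 ln_le_minus_one[of w] by (simp add: L_def)
  have n1: "?n \<ge> 1" using n by simp
  \<comment> \<open>Small enough that both the sum of the \<open>n\<close> errors and their
    quadratic sum defect stay bounded.\<close>
  define \<eta> where "\<eta> = 1 / ?n\<^sup>2"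
  have n2\<eta>: "?n\<^sup>2 * \<eta> = 1" using n by (simp add: \<eta>_def)
  have n\<eta>: "?n * \<eta> \<le> 1" using n1 by (simp add: \<eta>_def power2_eq_square)
  have \<eta>1: "\<eta> \<le> 1" using one_le_power[OF n1, of 2] by (auto simp: \<eta>_def divide_le_eq_1)
  define d where "d i = \<beta> (x i) - y i" for i
  have d: "norm (d i) \<le> \<eta>" if "i < n" for i using near[OF that] by (simp add: d_def \<eta>_def)
  \<comment> \<open>The terms carrying a single index each. Signs factor out of them by homogeneity,
    so their signed sum is controlled by the choice of signs instead of a triangle
    inequality.\<close>
  define r where "r i = g (x i) + kp_defect (y i) (d i) - ln (norm (y i)) *\<^sub>R y i" for i
  \<comment> \<open>\<open>C1\<close> bounds \<open>E\<close> relative to \<open>sqrt n\<close>, its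
    summands following the terms of \<open>E\<close> in order; \<open>C2\<close> bounds each
    \<open>r i\<close>.\<close>
  define C1 where "C1 = (1 + (b + 1)\<^sup>2) + 4 + 4 * (b + 2) + C + 1"
  define C2 where "C2 = 1 + b\<^sup>2 + 4 * (b + 1) + C"
  have r_le: "norm (r i) \<le> C2" if "i < n" for i
  proof -
    have "norm (g (x i)) \<le> C" using g_le[of "x i"] x[OF that] by simp
    moreover have "norm (kp_defect (y i) (d i)) \<le> 4 * (b + 1)"
      using norm_kp_defect_le[of "y i" "d i"] y[OF that] d[OF that] \<eta>1 by simp
    moreover have "norm (ln (norm (y i)) *\<^sub>R y i) \<le> 1 + b\<^sup>2"
    proof -
      have "norm (ln (norm (y i)) *\<^sub>R y i) = \<bar>norm (y i) * ln (norm (y i))\<bar>"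
        by (simp add: abs_mult mult.commute)
      also have "\<dots> \<le> 1 + (norm (y i))\<^sup>2" by (rule abs_mult_ln_le) simp
      also have "\<dots> \<le> 1 + b\<^sup>2" using y[OF that] by (simp add: power_mono)
      finally show ?thesis .
    qed
    ultimately show ?thesis
      using norm_triangle_ineq[of "g (x i)" "kp_defect (y i) (d i)"]
        norm_triangle_ineq4[of "g (x i) + kp_defect (y i) (d i)" "ln (norm (y i)) *\<^sub>R y i"]
      unfolding r_def C2_def by linarith
  qed
  \<comment> \<open>The weight \<open>c = 2\<close> matches the later estimate of the squared norm
    of a sum by twice the sum of the squared norms, so the terms with \<open>r\<close>
    cancel.\<close>
  obtain s :: "nat \<Rightarrow> real" where s: "\<And>i. \<bar>s i\<bar> = 1"
    and s_le: "(\<Sum>i<n. (norm (L *\<^sub>R (\<alpha> (x i) - \<beta> (x i))))\<^sup>2 - 2 * (norm (r i))\<^sup>2)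
      \<le> (norm (\<Sum>i<n. s i *\<^sub>R L *\<^sub>R (\<alpha> (x i) - \<beta> (x i))))\<^sup>2 - 2 * (norm (\<Sum>i<n. s i *\<^sub>R r i))\<^sup>2"
    using signs_parallelogram[where n = n and c = 2 and b = r
        and a = "\<lambda>i. L *\<^sub>R (\<alpha> (x i) - \<beta> (x i))"] by blast
  define X where "X = (\<Sum>i<n. s i *\<^sub>R x i)"
  define Y where "Y = (\<Sum>i<n. s i *\<^sub>R y i)"
  define D where "D = (\<Sum>i<n. s i *\<^sub>R d i)"
  define Q where "Q = kp_sum_defect (\<lambda>i. s i *\<^sub>R d i) n"
  define E where "E = (ln (norm Y) - L) *\<^sub>R Y - Q - kp_defect Y D - g X - L *\<^sub>R D"
  have X: "norm X = w"
    unfolding X_def w_def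
  proof (rule norm_sum_orthonormal_signs)
    show "inner (x i) (x j) = 0" if "i < n" "j < n" "i \<noteq> j" for i j
      by (rule inner_l2_disjoint[OF x_disjoint[OF that]])
  qed (use x s in auto)
  have \<beta>X: "\<beta> X = Y + D"
    by (simp add: X_def Y_def D_def d_def \<beta>.sum \<beta>.scaleR scaleR_diff_right sum_subtractf)
  have "(norm (s i *\<^sub>R v)) = norm v" for i and v :: l2 using s by simp
  note norm_s = this
  have D: "norm D \<le> ?n * \<eta>"
    unfolding D_def using sum_norm_bound[of "{..<n}" "\<lambda>i. s i *\<^sub>R d i" \<eta>] d s by simp
  have Qle: "norm Q \<le> 4"
    using norm_kp_sum_defect_le[of n "\<lambda>i. s i *\<^sub>R d i" \<eta>] d s n2\<eta> unfolding Q_def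
    by (simp add: mult.assoc)
  have Y: "norm Y \<le> (b + 1) * w"
  proof -
    have "norm Y \<le> norm (\<beta> X) + norm D" using norm_triangle_ineq4[of "\<beta> X" D] by (simp add: \<beta>X)
    also have "\<dots> \<le> b * w + 1 * w" using b(2)[of X, unfolded X] D n\<eta> w1 by linarith
    finally show ?thesis by (simp add: algebra_simps)
  qed
  \<comment> \<open>Subtracting \<open>L *\<^sub>R \<beta> X\<close> replaces the factor
    \<open>ln (norm Y)\<close> of \<open>Y\<close> by \<open>ln (norm Y) - L\<close>, which removes
    the growth in \<open>n\<close> from that term.\<close>
  have split: "L *\<^sub>R (\<alpha> X - \<beta> X) = E + (\<Sum>i<n. s i *\<^sub>R r i)"
  proof -
    have QX: "kp_sum_defect (\<lambda>i. s i *\<^sub>R x i) n = - L *\<^sub>R X"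
    proof -
      have "kp_sum_defect (\<lambda>i. s i *\<^sub>R x i) n =
          (\<Sum>i<n. ln (norm (s i *\<^sub>R x i)) *\<^sub>R s i *\<^sub>R x i) - ln (norm X) *\<^sub>R X"
        unfolding X_def by (rule kp_sum_defect_disjoint) (use x_disjoint in \<open>fastforce simp: scaleR_fun_def\<close>)
      also have "(\<Sum>i<n. ln (norm (s i *\<^sub>R x i)) *\<^sub>R s i *\<^sub>R x i) = 0"
        using x by (intro sum.neutral) (simp only: norm_s, simp)
      finally show ?thesis by (simp add: X L_def)
    qed
    have QY: "kp_sum_defect (\<lambda>i. s i *\<^sub>R y i) n =
        (\<Sum>i<n. s i *\<^sub>R ln (norm (y i)) *\<^sub>R y i) - ln (norm Y) *\<^sub>R Y"
    proof -
      have "kp_sum_defect (\<lambda>i. s i *\<^sub>R y i) n =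
          (\<Sum>i<n. ln (norm (s i *\<^sub>R y i)) *\<^sub>R s i *\<^sub>R y i) - ln (norm Y) *\<^sub>R Y"
        unfolding Y_def by (rule kp_sum_defect_disjoint) (use y_disjoint in \<open>fastforce simp: scaleR_fun_def\<close>)
      then show ?thesis unfolding norm_s by (simp add: mult.commute)
    qed
    have \<beta>s: "(\<lambda>i. \<beta> (s i *\<^sub>R x i)) = (\<lambda>i. s i *\<^sub>R y i + s i *\<^sub>R d i)"
      by (simp add: d_def \<beta>.scaleR scaleR_diff_right)
    have "\<alpha> (- L *\<^sub>R X) - kp_sum_defect (\<lambda>i. s i *\<^sub>R y i + s i *\<^sub>R d i) n
        = g X - (\<Sum>i<n. s i *\<^sub>R g (x i))"
      using twist_sum[of "\<lambda>i. s i *\<^sub>R x i" n] unfolding QX \<beta>s X_def[symmetric] g_scaleR .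
    then have "L *\<^sub>R \<alpha> X = - (kp_sum_defect (\<lambda>i. s i *\<^sub>R y i) n + Q + kp_defect Y D
        - (\<Sum>i<n. s i *\<^sub>R kp_defect (y i) (d i))) - g X + (\<Sum>i<n. s i *\<^sub>R g (x i))"
      unfolding kp_sum_defect_add kp_defect_scaleR Q_def Y_def D_def
      by (simp add: \<alpha>.scaleR \<alpha>.neg algebra_simps)
    moreover have "(\<Sum>i<n. s i *\<^sub>R r i) = (\<Sum>i<n. s i *\<^sub>R g (x i))
        + (\<Sum>i<n. s i *\<^sub>R kp_defect (y i) (d i)) - (\<Sum>i<n. s i *\<^sub>R ln (norm (y i)) *\<^sub>R y i)"
      unfolding r_def scaleR_diff_right scaleR_add_right sum_subtractf sum.distrib by simp
    ultimately show ?thesis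
      unfolding QY E_def \<beta>X scaleR_diff_right scaleR_add_right scaleR_diff_left by simp
  qed
  have E: "norm E \<le> C1 * w"
  proof -
    have "norm ((ln (norm Y) - L) *\<^sub>R Y) \<le> (1 + (b + 1)\<^sup>2) * w"
    proof (cases "Y = 0")
      case False
      \<comment> \<open>The factor becomes \<open>ln t\<close>, and \<open>t\<close> is bounded
        independently of \<open>n\<close>, so the norm is \<open>w\<close> times the bounded
        quantity \<open>\<bar>t * ln t\<bar>\<close>.\<close>
      define t where "t = norm Y / w"
      have t: "0 \<le> t" "t \<le> b + 1" using Y w1 by (auto simp: t_def field_simps)
      have "ln (norm Y) - L = ln t" using False w1 by (simp add: t_def L_def ln_div)
      then have "norm ((ln (norm Y) - L) *\<^sub>R Y) = w * \<bar>t * ln t\<bar>"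
        using w1 by (simp add: t_def abs_mult)
      also have "\<dots> \<le> w * (1 + t\<^sup>2)"
        using w1 abs_mult_ln_le[OF t(1)] by (intro mult_left_mono) auto
      also have "\<dots> \<le> w * (1 + (b + 1)\<^sup>2)"
        using w1 t by (intro mult_left_mono add_left_mono power_mono) auto
      finally show ?thesis by (simp add: mult.commute)
    qed (use w1 in simp)
    moreover have "norm (kp_defect Y D) \<le> 4 * (b + 2) * w"
    proof -
      have "norm (kp_defect Y D) \<le> 4 * (norm Y + norm D)" by (rule norm_kp_defect_le)
      also have "\<dots> \<le> 4 * ((b + 1) * w + w)"
        using Y D n\<eta> w1 by (intro mult_left_mono add_mono) auto
      finally show ?thesis by (simp add: algebra_simps)
    qed
    moreover have "norm (g X) \<le> C * w" using g_le[of X] X by simp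
    moreover have "norm (L *\<^sub>R D) \<le> 1 * w"
    proof -
      have "norm (L *\<^sub>R D) \<le> w * 1" unfolding norm_scaleR using L0 Lw D n\<eta> by (intro mult_mono) auto
      then show ?thesis by simp
    qed
    moreover have "norm Q \<le> 4 * w" using Qle w1 by simp
    moreover have "norm E \<le> norm ((ln (norm Y) - L) *\<^sub>R Y) + norm Q + norm (kp_defect Y D)
        + norm (g X) + norm (L *\<^sub>R D)"
      unfolding E_def by (intro norm_triangle_le_diff add_mono order_refl)
    ultimately show ?thesis unfolding C1_def distrib_right by linarith
  qed
  \<comment> \<open>The lower bound adds up \<open>n\<close> equal terms and the upper bound
    \<open>2 * (C1 * w)\<^sup>2\<close> is linear in \<open>n\<close> as well, so \<open>n\<close>
    cancels.\<close>
  have "?n * ((L * e)\<^sup>2 - 2 * C2\<^sup>2) = (\<Sum>i<n. (L * e)\<^sup>2 - 2 * C2\<^sup>2)" by simp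
  also have "\<dots> \<le> (\<Sum>i<n. (norm (L *\<^sub>R (\<alpha> (x i) - \<beta> (x i))))\<^sup>2 - 2 * (norm (r i))\<^sup>2)"
  proof (intro sum_mono diff_mono mult_left_mono power_mono)
    fix i assume i: "i \<in> {..<n}"
    show "L * e \<le> norm (L *\<^sub>R (\<alpha> (x i) - \<beta> (x i)))"
      using L0 large[of i] i by (simp add: mult_left_mono)
    show "norm (r i) \<le> C2" using r_le i by simp
  qed (use L0 e in auto)
  also have "\<dots> \<le> (norm (E + (\<Sum>i<n. s i *\<^sub>R r i)))\<^sup>2 - 2 * (norm (\<Sum>i<n. s i *\<^sub>R r i))\<^sup>2"
  proof -
    have "(\<Sum>i<n. s i *\<^sub>R L *\<^sub>R (\<alpha> (x i) - \<beta> (x i))) = L *\<^sub>R (\<alpha> X - \<beta> X)"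
      by (simp add: X_def \<alpha>.sum \<beta>.sum \<alpha>.scaleR \<beta>.scaleR scaleR_diff_right scaleR_sum_right
          sum_subtractf mult.commute)
    then show ?thesis using s_le split by simp
  qed
  also have "\<dots> \<le> 2 * (norm E)\<^sup>2"
  proof -
    have "(norm (u + v))\<^sup>2 \<le> 2 * (norm u)\<^sup>2 + 2 * (norm v)\<^sup>2" for u v :: l2
    proof -
      have "(norm (u + v))\<^sup>2 \<le> (norm u + norm v)\<^sup>2" by (intro power_mono norm_triangle_ineq) auto
      also have "\<dots> \<le> 2 * (norm u)\<^sup>2 + 2 * (norm v)\<^sup>2"
        using sum_squares_bound[of "norm u" "norm v"] by (simp add: power2_sum)
      finally show ?thesis .
    qed
    from this[of E "\<Sum>i<n. s i *\<^sub>R r i"] show ?thesis by simp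
  qed
  also have "\<dots> \<le> 2 * (C1 * w)\<^sup>2" using E by (intro mult_left_mono power_mono) auto
  also have "\<dots> = ?n * (2 * C1\<^sup>2)" by (simp add: power_mult_distrib w_def)
  finally have "(L * e)\<^sup>2 - 2 * C2\<^sup>2 \<le> 2 * C1\<^sup>2" using n by simp
  then show ?thesis unfolding L_def w_def C1_def C2_def by simp
qed

text \<open>A gliding hump: far out on a tail, \<open>\<beta> x\<close> has little mass on the first
  \<open>N\<close> coordinates; a finite truncation of \<open>x\<close> keeps the lower bound, and
  the right end is then moved past the support of \<open>x\<close> and most of
  \<open>\<beta> x\<close>.\<close>

lemma exists_block:
  assumes "e > 0" "\<eta> > 0"
    and large: "\<And>N. \<exists>x. restrict_l2 {..<N} x = 0 \<and> e * norm x < norm (\<alpha> x - \<beta> x)"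
  shows "\<exists>x N'. N \<le> N' \<and> norm x = 1 \<and> restrict_l2 {N..<N'} x = x \<and> e \<le> norm (\<alpha> x - \<beta> x) \<and>
    norm (\<beta> x - restrict_l2 {N..<N'} (\<beta> x)) \<le> \<eta>"
proof -
  interpret r: bounded_linear "restrict_l2 S" for S by (rule bounded_linear_restrict_l2)
  have coord_bl: "bounded_linear (\<lambda>x. coord (\<beta> x) i)" for i
  proof (rule bounded_linear_compose[OF _ \<beta>])
    show "bounded_linear (\<lambda>x. coord x i)"
      by (rule bounded_linear_intro[where K = 1]) (simp_all add: scaleR_fun_def abs_coord_le_norm)
  qed
  \<comment> \<open>The first \<open>N\<close> coordinates of \<open>\<beta> x\<close> are finitely
    many bounded functionals of \<open>x\<close>.\<close>
  have "tail_small (\<lambda>x. restrict_l2 {..<N} (\<beta> x))"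
    unfolding restrict_l2_eq_sum
    by (intro tail_small_sum tail_small_scaleR_functional coord_bl) simp
  then obtain M where M: "\<And>x. restrict_l2 {..<M} x = 0 \<Longrightarrow> norm (restrict_l2 {..<N} (\<beta> x)) \<le> \<eta> / 2 * norm x"
    using \<open>\<eta> > 0\<close> unfolding tail_small_def by (meson half_gt_zero)
  obtain z where z: "restrict_l2 {..<max M N} z = 0" "e * norm z < norm (\<alpha> z - \<beta> z)"
    using large by blast
  \<comment> \<open>The strict inequality is an open condition, so it passes to a far truncation; it
    also forces that truncation to be nonzero, which permits normalisation.\<close>
  have "(\<lambda>n. norm (\<alpha> (restrict_l2 {..<n} z) - \<beta> (restrict_l2 {..<n} z)) - e * norm (restrict_l2 {..<n} z))
    \<longlonglongrightarrow> norm (\<alpha> z - \<beta> z) - e * norm z"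
    by (intro tendsto_intros \<alpha>.tendsto \<beta>.tendsto restrict_l2_tendsto)
  moreover have "0 < norm (\<alpha> z - \<beta> z) - e * norm z" using z by simp
  ultimately have "\<forall>\<^sub>F n in sequentially.
      0 < norm (\<alpha> (restrict_l2 {..<n} z) - \<beta> (restrict_l2 {..<n} z)) - e * norm (restrict_l2 {..<n} z)"
    by (rule order_tendstoD)
  then obtain n where n: "e * norm (restrict_l2 {..<n} z)
      < norm (\<alpha> (restrict_l2 {..<n} z) - \<beta> (restrict_l2 {..<n} z))"
    unfolding eventually_sequentially by auto
  define v where "v = restrict_l2 {..<n} z"
  have v0: "v \<noteq> 0" using n by (auto simp: v_def[symmetric] \<alpha>.zero \<beta>.zero)
  define x where "x = (1 / norm v) *\<^sub>R v"
  have x: "norm x = 1" using v0 by (simp add: x_def)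
  have cx: "coord x i = 0" if "i < max M N \<or> n \<le> i" for i
    using that z(1) unfolding restrict_l2_tail x_def v_def
    by (auto simp: scaleR_fun_def coord_restrict_l2)
  have "norm (\<alpha> x - \<beta> x) = norm (\<alpha> v - \<beta> v) / norm v"
    by (simp add: x_def \<alpha>.scaleR \<beta>.scaleR flip: scaleR_diff_right)
  then have ex: "e \<le> norm (\<alpha> x - \<beta> x)"
    using n v0 unfolding v_def[symmetric] by (simp add: pos_le_divide_eq less_imp_le)
  have "\<eta> / 2 > 0" using \<open>\<eta> > 0\<close> by simp
  from LIMSEQ_D[OF restrict_l2_tendsto[of "\<beta> x"] this] obtain m
    where m: "\<And>k. k \<ge> m \<Longrightarrow> norm (restrict_l2 {..<k} (\<beta> x) - \<beta> x) < \<eta> / 2" by blast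
  define N' where "N' = max N (max n m)"
  have "coord x i = 0" if "i \<notin> {N..<N'}" for i
    using cx[of i] that by (auto simp: N'_def less_max_iff_disj not_le)
  then have "restrict_l2 {N..<N'} x = x"
    by (intro l2_eqI) (simp only: coord_restrict_l2, simp)
  moreover have "norm (\<beta> x - restrict_l2 {N..<N'} (\<beta> x)) \<le> \<eta>"
  proof -
    have eq: "\<beta> x - restrict_l2 {N..<N'} (\<beta> x)
        = restrict_l2 {..<N} (\<beta> x) - (restrict_l2 {..<N'} (\<beta> x) - \<beta> x)"
      by (rule l2_eqI) (auto simp: coord_restrict_l2 N'_def)
    have "norm (restrict_l2 {..<N} (\<beta> x)) \<le> \<eta> / 2"
    proof -
      have "restrict_l2 {..<M} x = 0"
        unfolding restrict_l2_tail using cx by (auto simp: less_max_iff_disj)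
      from M[OF this] show ?thesis by (simp add: x)
    qed
    moreover have "norm (restrict_l2 {..<N'} (\<beta> x) - \<beta> x) < \<eta> / 2" by (rule m) (simp add: N'_def)
    ultimately show ?thesis
      unfolding eq using norm_triangle_ineq4[of "restrict_l2 {..<N} (\<beta> x)" "restrict_l2 {..<N'} (\<beta> x) - \<beta> x"]
      by linarith
  qed
  moreover have "N \<le> N'" by (simp add: N'_def)
  ultimately show ?thesis using x ex by blast
qed

text \<open>If this fails, blocks exist for every \<open>n\<close> with the same \<open>e\<close>,
  and \<open>block_bound\<close> bounds \<open>ln (sqrt n)\<close> uniformly in
  \<open>n\<close>.\<close>

theorem tail_small_diff: "tail_small (\<lambda>x. \<alpha> x - \<beta> x)"
proof (rule ccontr)
  assume "\<not> tail_small (\<lambda>x. \<alpha> x - \<beta> x)"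
  then obtain e where e: "e > 0"
    and large: "\<And>N. \<exists>x. restrict_l2 {..<N} x = 0 \<and> e * norm x < norm (\<alpha> x - \<beta> x)"
    unfolding tail_small_def by (auto simp: not_le)
  obtain b where b: "b > 0" "\<And>v. norm (\<beta> v) \<le> b * norm v"
    using \<beta>.pos_bounded by (metis mult.commute)
  define K where "K = 2 * (((1 + (b + 1)\<^sup>2) + 4 + 4 * (b + 2) + C + 1)\<^sup>2 + (1 + b\<^sup>2 + 4 * (b + 1) + C)\<^sup>2)"
  have bound: "(ln (sqrt (real n)) * e)\<^sup>2 \<le> K" if n: "n > 0" for n
  proof -
    have "1 / (real n)\<^sup>2 > 0" using n by simp
    then have "\<forall>N. \<exists>x N'. N \<le> N' \<and> norm x = 1 \<and> restrict_l2 {N..<N'} x = x \<and> e \<le> norm (\<alpha> x - \<beta> x) \<and>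
        norm (\<beta> x - restrict_l2 {N..<N'} (\<beta> x)) \<le> 1 / (real n)\<^sup>2"
      using exists_block[OF e _ large] by blast
    then obtain X S where XS: "\<And>N. N \<le> S N" "\<And>N. norm (X N) = 1" "\<And>N. restrict_l2 {N..<S N} (X N) = X N"
      "\<And>N. e \<le> norm (\<alpha> (X N) - \<beta> (X N))"
      "\<And>N. norm (\<beta> (X N) - restrict_l2 {N..<S N} (\<beta> (X N))) \<le> 1 / (real n)\<^sup>2"
      by metis
    \<comment> \<open>Iterating the right-end function \<open>S\<close> from \<open>0\<close> gives
      consecutive intervals, which carry the disjoint blocks.\<close>
    define p where "p k = (S ^^ k) 0" for k
    have pS: "p (Suc k) = S (p k)" for k by (simp add: p_def)
    have "p k \<le> p (Suc k)" for k unfolding pS by (rule XS(1))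
    then have p_mono: "p i \<le> p j" if "i \<le> j" for i j
      using lift_Suc_mono_le[of p i j] that by blast
    have disj: "k \<notin> {p i..<p (Suc i)} \<or> k \<notin> {p j..<p (Suc j)}" if "i \<noteq> j" for i j k
    proof (cases "i < j")
      case True
      then show ?thesis using p_mono[of "Suc i" j] by auto
    next
      case False
      then show ?thesis using p_mono[of "Suc j" i] that by auto
    qed
    define x where "x i = X (p i)" for i
    define y where "y i = restrict_l2 {p i..<p (Suc i)} (\<beta> (x i))" for i
    have cx: "coord (x i) k = 0" if "k \<notin> {p i..<p (Suc i)}" for i k
      using that XS(3)[of "p i"] coord_restrict_l2[of "{p i..<p (Suc i)}" "x i" k]
      unfolding pS x_def by (simp only: if_False)
    have cy: "coord (y i) k = 0" if "k \<notin> {p i..<p (Suc i)}" for i k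
      using that unfolding y_def by (simp only: coord_restrict_l2 if_False)
    have ny: "norm (y i) \<le> b" for i
    proof -
      have "norm (y i) \<le> norm (\<beta> (x i))" unfolding y_def by (rule norm_restrict_l2_le)
      also have "\<dots> \<le> b" using b(2)[of "x i"] XS(2)[of "p i"] by (simp add: x_def)
      finally show ?thesis .
    qed
    show ?thesis
      unfolding K_def
    proof (rule block_bound[where x = x and y = y])
      show "coord (x i) k = 0 \<or> coord (x j) k = 0" if "i \<noteq> j" for i j k
        using disj[OF that] cx by blast
      show "coord (y i) k = 0 \<or> coord (y j) k = 0" if "i \<noteq> j" for i j k
        using disj[OF that] cy by blast
      show "norm (\<beta> (x i) - y i) \<le> 1 / (real n)\<^sup>2" for i
        using XS(5)[of "p i"] by (simp add: y_def x_def pS)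
      show "norm (x i) = 1" "e \<le> norm (\<alpha> (x i) - \<beta> (x i))" for i using XS by (simp_all add: x_def)
    qed (use n b e ny in auto)
  qed
  have "K \<ge> 0" by (simp add: K_def)
  \<comment> \<open>Large enough for \<open>ln (sqrt n) * e \<ge> K + 1\<close>; the factor
    \<open>2\<close> compensates for the square root.\<close>
  define n where "n = nat \<lceil>exp (2 * ((K + 1) / e))\<rceil>"
  have n: "real n \<ge> exp (2 * ((K + 1) / e))" unfolding n_def by linarith
  then have "real n > 0" by (meson exp_gt_zero less_le_trans)
  then have "n > 0" by simp
  have "2 * ((K + 1) / e) \<le> ln (real n)" using n \<open>real n > 0\<close> by (simp add: ln_ge_iff)
  moreover have "ln (sqrt (real n)) = ln (real n) / 2" using \<open>real n > 0\<close> by (simp add: ln_sqrt)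
  ultimately have "(K + 1) / e \<le> ln (sqrt (real n))" by linarith
  then have "K + 1 \<le> ln (sqrt (real n)) * e" using e by (simp add: pos_divide_le_eq)
  then have "(K + 1)\<^sup>2 \<le> (ln (sqrt (real n)) * e)\<^sup>2" using \<open>K \<ge> 0\<close> by (intro power_mono) auto
  then have "(K + 1)\<^sup>2 \<le> K" using bound[OF \<open>n > 0\<close>] by linarith
  moreover have "K < (K + 1)\<^sup>2" using \<open>K \<ge> 0\<close> by (simp add: power2_eq_square algebra_simps add_strict_increasing)
  ultimately show False by simp
qed

end

section \<open>Complex structures on hyperplanes of Z2\<close>

text \<open>Parametrises \<open>Z2\<close> bijectively by pairs in \<open>l2\<close>: the quasi-norm
  becomes the sum of two norms, and the nonlinearity moves into the addition.\<close>

definition Z2_elt :: "l2 \<Rightarrow> l2 \<Rightarrow> (nat \<Rightarrow> real) \<times> (nat \<Rightarrow> real)" where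
  "Z2_elt b x = (coord b + kalton_peck (coord x), coord x)"

lemma Z2_elt_in_Z2: "Z2_elt b x \<in> Z2"
  by (simp add: Z2_elt_def Z2_def)

lemma Z2_cases:
  assumes "z \<in> Z2"
  obtains b x where "z = Z2_elt b x"
proof -
  obtain w v where z: "z = (w, v)" "v \<in> ell2" "w - kalton_peck v \<in> ell2"
    using assms by (auto simp: Z2_def)
  then have "z = Z2_elt (Abs_l2 (w - kalton_peck v)) (Abs_l2 v)"
    by (simp add: Z2_elt_def Abs_l2_inverse)
  then show ?thesis by (rule that)
qed

lemma Z2_elt_inject: "Z2_elt b x = Z2_elt b' x' \<longleftrightarrow> b = b' \<and> x = x'"
  by (auto simp: Z2_elt_def coord_inject)

lemma Z2_elt_add:
  "Z2_elt b x + Z2_elt b' x' = Z2_elt (b + b' - kp_defect x x') (x + x')"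
proof -
  have "coord (b + b' - kp_defect x x') = coord b + coord b'
      - (kalton_peck (coord (x + x')) - kalton_peck (coord x) - kalton_peck (coord x'))"
    by (simp only: coord_simps coord_kp_defect)
  then show ?thesis by (simp add: Z2_elt_def)
qed

lemma Z2_elt_scaleR: "c *\<^sub>R Z2_elt b x = Z2_elt (c *\<^sub>R b) (c *\<^sub>R x)"
  by (simp add: Z2_elt_def kalton_peck_scaleR scaleR_right_distrib)

lemma Z2_elt_zero: "Z2_elt 0 0 = 0"
  by (simp add: Z2_elt_def kalton_peck_zero zero_prod_def)

lemma Z2_norm_elt: "Z2_norm (Z2_elt b x) = norm b + norm x"
  by (simp add: Z2_norm_def Z2_elt_def ell2_norm_coord)

lemma ell2_in_Z2_iff: "z \<in> ell2_in_Z2 \<longleftrightarrow> (\<exists>b. z = Z2_elt b 0)"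
proof
  assume "z \<in> ell2_in_Z2"
  then obtain v where "v \<in> ell2" "z = (v, 0)" by (auto simp: ell2_in_Z2_def)
  then have "z = Z2_elt (Abs_l2 v) 0"
    by (simp add: Z2_elt_def Abs_l2_inverse kalton_peck_zero)
  then show "\<exists>b. z = Z2_elt b 0" by blast
qed (auto simp: ell2_in_Z2_def Z2_elt_def kalton_peck_zero)

lemma subspace_Z2: "subspace Z2"
proof (rule subspaceI)
  show "0 \<in> Z2" using Z2_elt_in_Z2[of 0 0] by (simp add: Z2_elt_zero)
  show "z + z' \<in> Z2" if "z \<in> Z2" "z' \<in> Z2" for z z'
    using that by (auto elim!: Z2_cases simp: Z2_elt_add Z2_elt_in_Z2)
  show "c *\<^sub>R z \<in> Z2" if "z \<in> Z2" for c z
    using that by (auto elim!: Z2_cases simp: Z2_elt_scaleR Z2_elt_in_Z2)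
qed

lemma Z2_norm_scaleR: "z \<in> Z2 \<Longrightarrow> Z2_norm (c *\<^sub>R z) = \<bar>c\<bar> * Z2_norm z"
  by (auto elim!: Z2_cases simp: Z2_elt_scaleR Z2_norm_elt distrib_left)

lemma Z2_norm_nonneg: "z \<in> Z2 \<Longrightarrow> 0 \<le> Z2_norm z"
  by (auto elim!: Z2_cases simp: Z2_norm_elt)

text \<open>The constant is the \<open>4\<close> from the defect estimate plus \<open>1\<close> from
  the second component.\<close>

lemma Z2_norm_add_le:
  assumes "z \<in> Z2" "z' \<in> Z2"
  shows "Z2_norm (z + z') \<le> 5 * (Z2_norm z + Z2_norm z')"
proof -
  obtain b x b' x' where z: "z = Z2_elt b x" "z' = Z2_elt b' x'"
    using assms by (auto elim!: Z2_cases)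
  have "norm (b + b' - kp_defect x x') \<le> norm b + norm b' + 4 * (norm x + norm x')"
    using norm_triangle_ineq4[of "b + b'" "kp_defect x x'"] norm_triangle_ineq[of b b']
      norm_kp_defect_le[of x x'] by linarith
  moreover have "norm (x + x') \<le> norm x + norm x'" by (rule norm_triangle_ineq)
  moreover have "0 \<le> norm b" "0 \<le> norm b'" by simp_all
  ultimately show ?thesis
    unfolding z Z2_elt_add Z2_norm_elt distrib_left by linarith
qed

section \<open>Closed hyperplanes as kernels of bounded functionals\<close>

lemma topspace_quasinorm_topology: "topspace (quasinorm_topology X N) = X"
proof -
  have "openin (quasinorm_topology X N) X"
    unfolding openin_quasinorm_topology by (auto intro: exI[of _ 1])
  moreover have "S \<subseteq> X" if "openin (quasinorm_topology X N) S" for S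
    using that unfolding openin_quasinorm_topology by blast
  ultimately show ?thesis unfolding topspace_def by blast
qed

text \<open>\<open>f\<close> is the coefficient along \<open>z\<close>. As the complement of
  \<open>H\<close> is open, it contains a ball of radius \<open>e\<close> about \<open>z\<close>. If
  \<open>\<bar>f y\<bar>\<close> exceeded \<open>N y / e\<close>, the point
  \<open>z - y / f y\<close> would lie both in this ball and in \<open>H\<close>.\<close>

lemma closed_hyperplane_functional:
  assumes X: "subspace X" and H: "closed_hyperplane X N H"
    and N: "\<And>c x. x \<in> X \<Longrightarrow> N (c *\<^sub>R x) = \<bar>c\<bar> * N x"
    and N0: "\<And>x. x \<in> X \<Longrightarrow> 0 \<le> N x"
  obtains f :: "'a::real_vector \<Rightarrow> real" and C z where
    "\<And>x y. x \<in> X \<Longrightarrow> y \<in> X \<Longrightarrow> f (x + y) = f x + f y"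
    "\<And>c x. x \<in> X \<Longrightarrow> f (c *\<^sub>R x) = c * f x"
    "H = {x\<in>X. f x = 0}" "\<And>x. x \<in> X \<Longrightarrow> \<bar>f x\<bar> \<le> C * N x" "z \<in> X" "f z = 1"
proof -
  have sH: "subspace H" and cH: "closedin (quasinorm_topology X N) H"
    using H by (auto simp: closed_hyperplane_def)
  obtain z where z: "z \<in> X" "z \<notin> H" and ex: "\<And>y. y \<in> X \<Longrightarrow> \<exists>h\<in>H. \<exists>c. y = h + c *\<^sub>R z"
    using H by (auto simp: closed_hyperplane_def)
  have HX: "H \<subseteq> X" and op: "openin (quasinorm_topology X N) (X - H)"
    using cH by (auto simp: closedin_def topspace_quasinorm_topology)
  have unique: "c = d" if "h \<in> H" "k \<in> H" "h + c *\<^sub>R z = k + d *\<^sub>R z" for h k c d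
  proof (rule ccontr)
    assume "c \<noteq> d"
    have "(c - d) *\<^sub>R z = k - h" using that(3) by (simp add: algebra_simps)
    then have "(c - d) *\<^sub>R z \<in> H" using sH that by (simp add: subspace_diff)
    then have "inverse (c - d) *\<^sub>R (c - d) *\<^sub>R z \<in> H" using sH by (rule subspace_scale[rotated])
    then show False using \<open>c \<noteq> d\<close> z(2) by simp
  qed
  define f where "f y = (THE c. \<exists>h\<in>H. y = h + c *\<^sub>R z)" for y
  have f: "f (h + c *\<^sub>R z) = c" if "h \<in> H" for h c
    unfolding f_def using that unique by (intro the_equality) blast+
  have add: "f (x + y) = f x + f y" if xy: "x \<in> X" "y \<in> X" for x y
  proof -
    obtain h c k d where *: "h \<in> H" "x = h + c *\<^sub>R z" "k \<in> H" "y = k + d *\<^sub>R z"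
      using ex[OF xy(1)] ex[OF xy(2)] by blast
    have "x + y = (h + k) + (c + d) *\<^sub>R z" using * by (simp add: algebra_simps)
    moreover have "h + k \<in> H" using * sH by (simp add: subspace_add)
    ultimately show ?thesis using * f by metis
  qed
  have scale: "f (c *\<^sub>R x) = c * f x" if x: "x \<in> X" for c x
  proof -
    obtain h d where *: "h \<in> H" "x = h + d *\<^sub>R z" using ex[OF x] by blast
    have "c *\<^sub>R x = c *\<^sub>R h + (c * d) *\<^sub>R z" using * by (simp add: algebra_simps)
    moreover have "c *\<^sub>R h \<in> H" using * sH by (simp add: subspace_scale)
    ultimately show ?thesis using * f by metis
  qed
  have ker: "H = {x\<in>X. f x = 0}"
  proof (intro equalityI subsetI)
    fix x assume x: "x \<in> H"
    then have "f (x + 0 *\<^sub>R z) = 0" by (rule f)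
    then show "x \<in> {x\<in>X. f x = 0}" using x HX by auto
  next
    fix x assume x: "x \<in> {x\<in>X. f x = 0}"
    then obtain h c where *: "h \<in> H" "x = h + c *\<^sub>R z" using ex by blast
    then have "c = 0" using f x by simp
    then show "x \<in> H" using * by simp
  qed
  have fz: "f z = 1" using f[of 0 1] sH by (simp add: subspace_0)
  obtain e where e: "e > 0" "\<And>y. y \<in> X \<Longrightarrow> N (y - z) < e \<Longrightarrow> y \<in> X - H"
    using op z unfolding openin_quasinorm_topology by blast
  have "\<bar>f y\<bar> \<le> (1 / e) * N y" if y: "y \<in> X" for y
  proof (rule ccontr)
    assume "\<not> \<bar>f y\<bar> \<le> (1 / e) * N y"
    then have lt: "N y < \<bar>f y\<bar> * e" using e(1) by (simp add: field_simps)
    have fy: "f y \<noteq> 0" using lt N0[OF y] by auto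
    define t where "t = - 1 / f y"
    have ty: "t *\<^sub>R y \<in> X" using X y by (rule subspace_scale)
    have "f (z + t *\<^sub>R y) = 0"
      unfolding add[OF z(1) ty] scale[OF y] fz using fy by (simp add: t_def)
    moreover have zX: "z + t *\<^sub>R y \<in> X" using X z(1) ty by (rule subspace_add)
    ultimately have "z + t *\<^sub>R y \<in> H" using ker by blast
    moreover have "N (t *\<^sub>R y) < e"
      unfolding N[OF y] using lt fy by (simp add: t_def field_simps)
    ultimately show False using e(2)[OF zX] by simp
  qed
  then show ?thesis using that add scale ker z(1) fz by blast
qed

section \<open>Excluding compatible complex structures\<close>

theorem theorem5p6:
  fixes H :: "((nat \<Rightarrow> real) \<times> (nat \<Rightarrow> real)) set"
    and u :: "(nat \<Rightarrow> real) \<times> (nat \<Rightarrow> real) \<Rightarrow> (nat \<Rightarrow> real) \<times> (nat \<Rightarrow> real)"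
  assumes "closed_hyperplane Z2 Z2_norm H"
    and "complex_structure_on H Z2_norm u"
  shows "\<not> compatible_with_subspace ell2_in_Z2 H u"
proof
  assume compat: "compatible_with_subspace ell2_in_Z2 H u"
  obtain f Cf z1 where f_add: "\<And>x y. x \<in> Z2 \<Longrightarrow> y \<in> Z2 \<Longrightarrow> f (x + y) = f x + f y"
    and f_scale: "\<And>c x. x \<in> Z2 \<Longrightarrow> f (c *\<^sub>R x) = c * f x"
    and H: "H = {x\<in>Z2. f x = 0}" and f_le: "\<And>x. x \<in> Z2 \<Longrightarrow> \<bar>f x\<bar> \<le> Cf * Z2_norm x"
    and z1: "z1 \<in> Z2" "f z1 = 1"
    using closed_hyperplane_functional[OF subspace_Z2 assms(1) Z2_norm_scaleR Z2_norm_nonneg]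
    by blast
  have u_in: "\<And>h. h \<in> H \<Longrightarrow> u h \<in> H"
    and u_add: "\<And>h k. h \<in> H \<Longrightarrow> k \<in> H \<Longrightarrow> u (h + k) = u h + u k"
    and u_scale: "\<And>c h. h \<in> H \<Longrightarrow> u (c *\<^sub>R h) = c *\<^sub>R u h"
    and u_sq: "\<And>h. h \<in> H \<Longrightarrow> u (u h) = - h"
    using assms(2) unfolding complex_structure_on_def bounded_operator_on_def by auto
  obtain Cu where u_le: "\<And>h. h \<in> H \<Longrightarrow> Z2_norm (u h) \<le> Cu * Z2_norm h"
    using assms(2) unfolding complex_structure_on_def bounded_operator_on_def by blast
  have uY: "u h \<in> ell2_in_Z2" if "h \<in> H" "h \<in> ell2_in_Z2" for h
    using compat that unfolding compatible_with_subspace_def by blast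
  \<comment> \<open>Either alternative makes the projection onto \<open>H\<close> along
    \<open>z0\<close> preserve \<open>ell2_in_Z2\<close>, so that compatibility of \<open>u\<close>
    passes to its extension.\<close>
  have "\<exists>z0\<in>Z2. f z0 = 1 \<and> (z0 \<in> ell2_in_Z2 \<or> (\<forall>b. f (Z2_elt b 0) = 0))"
  proof (cases "\<forall>b. f (Z2_elt b 0) = 0")
    case True
    then show ?thesis using z1 by blast
  next
    case False
    then obtain b where b: "f (Z2_elt b 0) \<noteq> 0" by blast
    let ?t = "1 / f (Z2_elt b 0)"
    have "f (?t *\<^sub>R Z2_elt b 0) = 1" using b by (simp add: f_scale Z2_elt_in_Z2)
    moreover have "?t *\<^sub>R Z2_elt b 0 \<in> ell2_in_Z2"
      unfolding ell2_in_Z2_iff Z2_elt_scaleR by auto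
    moreover have "?t *\<^sub>R Z2_elt b 0 \<in> Z2" by (simp add: Z2_elt_scaleR Z2_elt_in_Z2)
    ultimately show ?thesis by blast
  qed
  then obtain z0 where z0: "z0 \<in> Z2" "f z0 = 1"
    and z0_cases: "z0 \<in> ell2_in_Z2 \<or> (\<forall>b. f (Z2_elt b 0) = 0)" by blast
  \<comment> \<open>The projection of \<open>Z2\<close> onto \<open>H\<close> along
    \<open>z0\<close>.\<close>
  define p where "p z = z + (- f z) *\<^sub>R z0" for z
  have sc_in: "c *\<^sub>R z \<in> Z2" if "z \<in> Z2" for c z using that subspace_Z2 by (simp add: subspace_scale)
  have p_in: "p z \<in> H" if "z \<in> Z2" for z
    unfolding H p_def using that z0 subspace_Z2
    by (simp add: subspace_add sc_in f_add f_scale del: scaleR_minus_left)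
  have p_id: "p h = h" if "h \<in> H" for h using that by (simp add: p_def H)
  have p_add: "p (x + y) = p x + p y" if "x \<in> Z2" "y \<in> Z2" for x y
    using that by (simp add: p_def f_add algebra_simps)
  have p_scale: "p (c *\<^sub>R x) = c *\<^sub>R p x" if "x \<in> Z2" for c x
    using that by (simp add: p_def f_scale algebra_simps)
  define U where "U z = u (p z)" for z
  have U_in: "U z \<in> H" if "z \<in> Z2" for z using that by (simp add: U_def u_in p_in)
  have U_Z2: "U z \<in> Z2" if "z \<in> Z2" for z using U_in[OF that] H by blast
  have U_add: "U (x + y) = U x + U y" if "x \<in> Z2" "y \<in> Z2" for x y
    using that by (simp add: U_def p_add u_add p_in)
  have U_scale: "U (c *\<^sub>R x) = c *\<^sub>R U x" if "x \<in> Z2" for c x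
    using that by (simp add: U_def p_scale u_scale p_in)
  have U_sq: "U (U z) = - p z" if "z \<in> Z2" for z
    using U_in[OF that] p_in[OF that] by (simp add: U_def p_id u_sq u_in)
  have U_z0: "U z0 = 0"
  proof -
    have "U z0 = u (0 *\<^sub>R p z0)" using z0 by (simp add: U_def p_def)
    also have "\<dots> = 0" using p_in[OF z0(1)] by (subst u_scale) auto
    finally show ?thesis .
  qed
  obtain K where K: "\<And>z. z \<in> Z2 \<Longrightarrow> Z2_norm (U z) \<le> K * Z2_norm z"
  proof
    fix z assume z: "z \<in> Z2"
    have "\<bar>- f z\<bar> * Z2_norm z0 \<le> (Cf * Z2_norm z) * Z2_norm z0"
      using f_le[OF z] Z2_norm_nonneg[OF z0(1)] by (intro mult_right_mono) auto
    then have "Z2_norm ((- f z) *\<^sub>R z0) \<le> (Cf * Z2_norm z) * Z2_norm z0"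
      using Z2_norm_scaleR[OF z0(1), of "- f z"] by (simp only:)
    then have p_le: "Z2_norm (p z) \<le> 5 * (Z2_norm z + (Cf * Z2_norm z) * Z2_norm z0)"
      unfolding p_def
      by (intro order_trans[OF Z2_norm_add_le[OF z sc_in[OF z0(1)]]] mult_left_mono add_left_mono) auto
    have "Z2_norm (U z) \<le> Cu * Z2_norm (p z)" unfolding U_def by (rule u_le[OF p_in[OF z]])
    also have "\<dots> \<le> \<bar>Cu\<bar> * Z2_norm (p z)"
      using Z2_norm_nonneg p_in[OF z] H by (intro mult_right_mono) auto
    also have "\<dots> \<le> \<bar>Cu\<bar> * (5 * (Z2_norm z + (Cf * Z2_norm z) * Z2_norm z0))"
      using p_le by (intro mult_left_mono) auto
    finally show "Z2_norm (U z) \<le> (\<bar>Cu\<bar> * 5 * (1 + Cf * Z2_norm z0)) * Z2_norm z"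
      by (simp add: algebra_simps)
  qed
  have "\<exists>b'. U (Z2_elt b 0) = Z2_elt b' 0" for b
  proof -
    have "\<exists>b'. p (Z2_elt b 0) = Z2_elt b' 0"
      using z0_cases
    proof
      assume "z0 \<in> ell2_in_Z2"
      then obtain b0 where "z0 = Z2_elt b0 0" by (auto simp: ell2_in_Z2_iff)
      then show ?thesis unfolding p_def by (simp only: Z2_elt_scaleR Z2_elt_add) auto
    next
      assume "\<forall>b. f (Z2_elt b 0) = 0"
      then show ?thesis by (auto simp: p_def)
    qed
    then show ?thesis using uY[OF p_in] Z2_elt_in_Z2 unfolding U_def ell2_in_Z2_iff by metis
  qed
  then obtain \<alpha> where U\<alpha>: "\<And>b. U (Z2_elt b 0) = Z2_elt (\<alpha> b) 0" by metis
  \<comment> \<open>\<open>Z2_elt 0 x\<close> is a homogeneous, nonlinear lift of \<open>x\<close>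
    from the quotient; \<open>\<beta>\<close> is the quotient operator and \<open>g\<close> records
    how far \<open>U\<close> is from respecting the lift.\<close>
  have "\<exists>b' x'. U (Z2_elt 0 x) = Z2_elt b' x'" for x
    using U_Z2[OF Z2_elt_in_Z2] Z2_cases by metis
  then obtain g \<beta> where U\<beta>: "\<And>x. U (Z2_elt 0 x) = Z2_elt (g x) (\<beta> x)" by metis
  \<comment> \<open>The defect vanishes when one argument is zero, so this splitting is
    exact.\<close>
  have elt_split: "Z2_elt b 0 + Z2_elt 0 x = Z2_elt b x" for b x
    by (simp add: Z2_elt_add kp_defect_zero_left)
  have U_elt: "U (Z2_elt b x) = Z2_elt (\<alpha> b + g x) (\<beta> x)" for b x
    using U_add[OF Z2_elt_in_Z2 Z2_elt_in_Z2, of b 0 0 x]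
    by (simp add: elt_split U\<alpha> U\<beta>) (simp add: Z2_elt_add kp_defect_zero_left)
  have U_elt_add: "U (Z2_elt b x + Z2_elt b' x') = U (Z2_elt b x) + U (Z2_elt b' x')" for b x b' x'
    by (intro U_add Z2_elt_in_Z2)
  have U_elt_scale: "U (c *\<^sub>R Z2_elt b x) = c *\<^sub>R U (Z2_elt b x)" for c b x
    by (intro U_scale Z2_elt_in_Z2)
  have \<alpha>_bl: "bounded_linear \<alpha>"
  proof (rule bounded_linear_intro[where K = K])
    show "\<alpha> (b + b') = \<alpha> b + \<alpha> b'" for b b'
      using U_elt_add[of b 0 b' 0] by (simp add: Z2_elt_add U\<alpha> kp_defect_zero_left Z2_elt_inject)
    show "\<alpha> (c *\<^sub>R b) = c *\<^sub>R \<alpha> b" for c b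
      using U_elt_scale[of c b 0] by (simp add: Z2_elt_scaleR U\<alpha> Z2_elt_inject)
    show "norm (\<alpha> b) \<le> norm b * K" for b
      using K[OF Z2_elt_in_Z2, of b 0] by (simp add: U\<alpha> Z2_norm_elt mult.commute)
  qed
  interpret \<alpha>: bounded_linear \<alpha> by fact
  \<comment> \<open>Additivity of \<open>U\<close> on two lifts, whose sum differs from the lift of
    the sum by a defect; the first component is the locale identity \<open>twist\<close>.\<close>
  have U_sum: "\<alpha> (- kp_defect x y) + g (x + y) = g x + g y - kp_defect (\<beta> x) (\<beta> y) \<and>
      \<beta> (x + y) = \<beta> x + \<beta> y" for x y
    using U_elt_add[of 0 x 0 y] by (simp add: Z2_elt_add U_elt Z2_elt_inject)
  have gb_le: "norm (g x) + norm (\<beta> x) \<le> K * norm x" for x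
    using K[OF Z2_elt_in_Z2, of 0 x] by (simp add: U\<beta> Z2_norm_elt)
  have gb_scale: "g (c *\<^sub>R x) = c *\<^sub>R g x \<and> \<beta> (c *\<^sub>R x) = c *\<^sub>R \<beta> x" for c x
    using U_elt_scale[of c 0 x] by (simp add: Z2_elt_scaleR U\<beta> Z2_elt_inject)
  have \<beta>_bl: "bounded_linear \<beta>"
  proof (rule bounded_linear_intro[where K = K])
    show "norm (\<beta> x) \<le> norm x * K" for x
      using gb_le[of x] norm_ge_zero[of "g x"] mult.commute[of K "norm x"] by linarith
  qed (use U_sum gb_scale in auto)
  interpret \<beta>: bounded_linear \<beta> by fact
  interpret Z2_operator \<alpha> \<beta> g K
  proof
    show "norm (g x) \<le> K * norm x" for x
      using gb_le[of x] norm_ge_zero[of "\<beta> x"] by linarith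
    show "g (c *\<^sub>R x) = c *\<^sub>R g x" for c x using gb_scale by blast
    show "\<alpha> (kp_defect x y) - kp_defect (\<beta> x) (\<beta> y) = g (x + y) - g x - g y" for x y
      using U_sum[of x y] by (simp add: \<alpha>.neg algebra_simps)
  qed
  have f_elt: "f (Z2_elt b x) = f (Z2_elt b 0) + f (Z2_elt 0 x)" for b x
    using f_add[OF Z2_elt_in_Z2 Z2_elt_in_Z2, of b 0 0 x] unfolding elt_split .
  have neg_elt: "- Z2_elt b x = Z2_elt (- b) (- x)" for b x
    using Z2_elt_scaleR[of "- 1" b x] by simp
  have U_sq_elt: "U (U (Z2_elt b x)) = f (Z2_elt b x) *\<^sub>R z0 + Z2_elt (- b) (- x)" for b x
    unfolding U_sq[OF Z2_elt_in_Z2] p_def by (simp flip: neg_elt)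
  have f_bl: "bounded_linear (\<lambda>b. f (Z2_elt b 0))"
  proof (rule bounded_linear_intro[where K = Cf])
    show "f (Z2_elt (b + b') 0) = f (Z2_elt b 0) + f (Z2_elt b' 0)" for b b'
      using f_add[OF Z2_elt_in_Z2 Z2_elt_in_Z2, of b 0 b' 0] by (simp add: Z2_elt_add kp_defect_zero_left)
    show "f (Z2_elt (c *\<^sub>R b) 0) = c *\<^sub>R f (Z2_elt b 0)" for c b
      using f_scale[OF Z2_elt_in_Z2, of c b 0] by (simp add: Z2_elt_scaleR)
    show "norm (f (Z2_elt b 0)) \<le> norm b * Cf" for b
      using f_le[OF Z2_elt_in_Z2, of b 0] by (simp add: Z2_norm_elt mult.commute)
  qed
  show False
  proof (cases "\<forall>b. f (Z2_elt b 0) = 0")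
    \<comment> \<open>\<open>H\<close> contains \<open>ell2_in_Z2\<close>, so \<open>f\<close>
      descends to \<open>\<phi>\<close> on the quotient: \<open>\<alpha>\<close> squares to
      \<open>-1\<close>, and \<open>\<beta>\<close> is the hyperplane structure extended by zero
      along \<open>x0\<close>.\<close>
    case True
    define \<phi> where "\<phi> x = f (Z2_elt 0 x)" for x
    have f\<phi>: "f (Z2_elt b x) = \<phi> x" for b x using True f_elt[of b x] by (simp add: \<phi>_def)
    have "bounded_linear \<phi>"
    proof (rule bounded_linear_intro[where K = Cf])
      show "\<phi> (x + y) = \<phi> x + \<phi> y" for x y
        using f_add[OF Z2_elt_in_Z2 Z2_elt_in_Z2, of 0 x 0 y] unfolding Z2_elt_add f\<phi> .
      show "\<phi> (c *\<^sub>R x) = c *\<^sub>R \<phi> x" for c x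
        using f_scale[OF Z2_elt_in_Z2, of c 0 x] unfolding Z2_elt_scaleR f\<phi> by simp
      show "norm (\<phi> x) \<le> norm x * Cf" for x
        using f_le[OF Z2_elt_in_Z2, of 0 x] unfolding f\<phi> Z2_norm_elt by (simp add: mult.commute)
    qed
    obtain b0 x0 where z0_elt: "z0 = Z2_elt b0 x0" using z0(1) by (rule Z2_cases)
    have "\<phi> x0 = 1" using z0(2) unfolding z0_elt f\<phi> .
    have "\<beta> x0 = 0" using U_z0 unfolding z0_elt U_elt Z2_elt_zero[symmetric] Z2_elt_inject by blast
    have "\<beta> (\<beta> x) = \<phi> x *\<^sub>R x0 - x" for x
      using U_sq_elt[of 0 x] unfolding U_elt f\<phi> z0_elt Z2_elt_scaleR Z2_elt_add Z2_elt_inject by simp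
    moreover have "\<alpha> (\<alpha> b) = - b" for b
      using U_sq_elt[of b 0] True unfolding U\<alpha> by (simp add: Z2_elt_inject)
    ultimately show False
      using complex_structure_hyperplane_not_tail_small[OF \<alpha>_bl _ \<beta>_bl \<open>\<beta> x0 = 0\<close> _ \<open>bounded_linear \<phi>\<close> \<open>\<phi> x0 = 1\<close>]
        tail_small_diff by blast
  next
    \<comment> \<open>Now \<open>z0\<close> vanishes in the quotient and the roles of
      \<open>\<alpha>\<close> and \<open>\<beta>\<close> are exchanged.\<close>
    case False
    then obtain b0 where z0_elt: "z0 = Z2_elt b0 0" using z0_cases by (auto simp: ell2_in_Z2_iff)
    have "f (Z2_elt b0 0) = 1" using z0(2) unfolding z0_elt .
    have "\<alpha> b0 = 0" using U_z0 unfolding z0_elt U\<alpha> Z2_elt_zero[symmetric] Z2_elt_inject by blast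
    have "\<alpha> (\<alpha> b) = f (Z2_elt b 0) *\<^sub>R b0 - b" for b
      using U_sq_elt[of b 0]
      unfolding U\<alpha> z0_elt Z2_elt_scaleR Z2_elt_add Z2_elt_inject by (simp add: kp_defect_zero_left)
    moreover have "\<beta> (\<beta> x) = - x" for x
      using U_sq_elt[of 0 x] unfolding U_elt z0_elt Z2_elt_scaleR Z2_elt_add Z2_elt_inject by simp
    moreover have "tail_small (\<lambda>x. \<beta> x - \<alpha> x)"
      using tail_small_diff tail_small_uminus[of "\<lambda>x. \<alpha> x - \<beta> x"] by simp
    ultimately show False
      using complex_structure_hyperplane_not_tail_small[OF \<beta>_bl _ \<alpha>_bl \<open>\<alpha> b0 = 0\<close> _ f_bl \<open>f (Z2_elt b0 0) = 1\<close>]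
      by blast
  qed
qed

end
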